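(* Let $S_{\boldsymbol\lambda}$ be a densely defined weighted shift on a directed tree $\mathcal T=(V,\mathcal E)$ with weights $\boldsymbol\lambda=\{\lambda_v\}_{v\in V^\circ}\subseteq\mathbb C$, and let $E$ be the spectral measure of $|S_{\boldsymbol\lambda}|$. For $u\in V$ put $$\mathsf{Chi}_{\mathrm e}(u)=\{v\in\mathsf{Chi}(u)\colon\|S_{\boldsymbol\lambda}e_v\|=\|S_{\boldsymbol\lambda}e_u\|\},\qquad \mathsf{Chi}'(u)=\{v\in\mathsf{Chi}_{\mathrm e}(u)\colon\lambda_v\neq0\}.$$ Then the following assertions are valid. (i) For any $c\in\mathbb R_+$, $S_{\boldsymbol\lambda}$ is weakly quasinormal with $\mathfrak c_{S_{\boldsymbol\lambda}}\leqslant c$ if and only if $$\|S_{\boldsymbol\lambda}e_u\|^2\leqslant c\sum_{v\in\mathsf{Chi}_{\mathrm e}(u)}|\lambda_v|^2,\qquad u\in V$$ (with the convention that a sum over the empty set is $0$). (ii) $\langle E(\cdot)|S_{\boldsymbol\lambda}|f,|S_{\boldsymbol\lambda}|f\rangle\ll\langle E(\cdot)S_{\boldsymbol\lambda}f,S_{\boldsymbol\lambda}f\rangle$ for all $f\in\mathcal D(S_{\boldsymbol\lambda})$ if and only if for every $u\in V$, $\|S_{\boldsymbol\lambda}e_u\|\neq0$ implies $\mathsf{Chi}'(u)\neq\varnothing$.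
   Context: Directed trees: $\mathcal T=(V,\mathcal E)$ is a directed tree with (nonempty) vertex set $V$ and edge set $\mathcal E\subseteq\{(u,v)\in V\times V\colon u\neq v\}$, i.e. a directed graph that is connected (as an undirected graph), has no (directed) circuits, and in which each vertex $v$ has at most one $u$ with $(u,v)\in\mathcal E$; there is at most one vertex having no such $u$, called the root. $V^\circ=V\setminus\{\mathrm{root}\}$ if $\mathcal T$ has a root and $V^\circ=V$ otherwise. For $v\in V^\circ$, $\mathsf{par}(v)$ is the unique vertex with $(\mathsf{par}(v),v)\in\mathcal E$, and $\mathsf{Chi}(u)=\{v\in V\colon(u,v)\in\mathcal E\}$ for $u\in V$. Weighted shifts: $\ell^2(V)$ is the Hilbert space of square summable complex functions on $V$, with orthonormal basis $e_u=\chi_{\{u\}}$, $u\in V$. For $f\colon V\to\mathbb C$ let $(\Lambda_{\mathcal T}f)(v)=\lambda_v f(\mathsf{par}(v))$ if $v\in V^\circ$ and $(\Lambda_{\mathcal T}f)(\mathrm{root})=0$. The weighted shift $S_{\boldsymbol\lambda}$ on $\mathcal T$ with weights $\{\lambda_v\}_{v\in V^\circ}$ is the operator in $\ell^2(V)$ with domain $\mathcal D(S_{\boldsymbol\lambda})=\{f\in\ell^2(V)\colon\Lambda_{\mathcal T}f\in\ell^2(V)\}$ and $S_{\boldsymbol\lambda}f=\Lambda_{\mathcal T}f$. It is always closed, and if it is densely defined then every $e_u$ lies in $\mathcal D(S_{\boldsymbol\lambda})$. Operators: $\mathbb R_+=[0,\infty)$, $\mathfrak B(\mathbb R_+)$ is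 its Borel $\sigma$-algebra; for a closed densely defined $A$, $|A|=(A^*A)^{1/2}$, whose spectral measure is regarded as defined on $\mathfrak B(\mathbb R_+)$. A closed densely defined operator $A$ is weakly quasinormal if there exists $c\in\mathbb R_+$ such that $\langle E(\sigma)|A|f,|A|f\rangle\leqslant c\,\langle E(\sigma)Af,Af\rangle$ for all $\sigma\in\mathfrak B(\mathbb R_+)$ and $f\in\mathcal D(A)$, where $E$ is the spectral measure of $|A|$; the smallest such $c$ is denoted by $\mathfrak c_A$. For finite positive Borel measures on $\mathbb R_+$, $\mu\ll\nu$ means absolute continuity of $\mu$ with respect to $\nu$; $\langle E(\cdot)h,h\rangle$ is the measure $\sigma\mapsto\langle E(\sigma)h,h\rangle$. *)

theory Defs
  imports "HOL-Analysis.Analysis"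
begin

section \<open>Directed trees\<close>

text \<open>
  A directed graph is a vertex set \<open>V\<close> together with a set \<open>Ed\<close> of ordered pairs. That at most one
  vertex has no parent is a consequence of the conditions below, see \<open>directed_tree_root_unique\<close>.
\<close>

definition directed_tree :: "'a set \<Rightarrow> ('a \<times> 'a) set \<Rightarrow> bool" where
  "directed_tree V Ed \<longleftrightarrow>
     V \<noteq> {} \<and>
     Ed \<subseteq> {(u, v). u \<in> V \<and> v \<in> V \<and> u \<noteq> v} \<and>
     (\<forall>u\<in>V. \<forall>v\<in>V. (u, v) \<in> (Ed \<union> Ed\<inverse>)\<^sup>*) \<and>
     acyclic Ed \<and>
     (\<forall>v\<in>V. \<forall>u u'. (u, v) \<in> Ed \<longrightarrow> (u', v) \<in> Ed \<longrightarrow> u = u')"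

definition roots :: "'a set \<Rightarrow> ('a \<times> 'a) set \<Rightarrow> 'a set" where
  "roots V Ed = {v \<in> V. \<not> (\<exists>u. (u, v) \<in> Ed)}"

definition nonroots :: "'a set \<Rightarrow> ('a \<times> 'a) set \<Rightarrow> 'a set" where
  "nonroots V Ed = V - roots V Ed"

definition par :: "('a \<times> 'a) set \<Rightarrow> 'a \<Rightarrow> 'a" where
  "par Ed v = (THE u. (u, v) \<in> Ed)"

definition Chi :: "'a set \<Rightarrow> ('a \<times> 'a) set \<Rightarrow> 'a \<Rightarrow> 'a set" where
  "Chi V Ed u = {v \<in> V. (u, v) \<in> Ed}"

lemma directed_tree_root_unique:
  assumes T: "directed_tree V Ed" and r: "r \<in> roots V Ed" and s: "s \<in> roots V Ed"
  shows "r = s"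
proof -
  have uniq: "u = u'" if "(u, v) \<in> Ed" "(u', v) \<in> Ed" for u u' v
    using T that unfolding directed_tree_def by blast
  have "(r, s) \<in> (Ed \<union> Ed\<inverse>)\<^sup>*"
    using T r s by (simp add: directed_tree_def roots_def)
  then have "(r, s) \<in> Ed\<^sup>*"
  proof (induction rule: rtrancl_induct)
    case base
    show ?case by simp
  next
    case (step y z)
    show ?case
    proof (cases "(y, z) \<in> Ed")
      case True
      with step.IH show ?thesis by simp
    next
      case False
      then have zy: "(z, y) \<in> Ed" using step.hyps by blast
      from step.IH show ?thesis
      proof (cases rule: rtranclE)
        case base
        then show ?thesis using zy r unfolding roots_def by blast
      next
        case (step w)
        then show ?thesis using uniq[OF zy] by blast
      qed
    qed
  qed
  then show ?thesis
    using s by (cases rule: rtranclE) (auto simp: roots_def)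
qed

section \<open>The Hilbert space of square summable functions\<close>

text \<open>Functions on \<open>V\<close> are represented by functions on the whole type which vanish off \<open>V\<close>.\<close>

definition ell2 :: "'a set \<Rightarrow> ('a \<Rightarrow> complex) set" where
  "ell2 V = {f. (\<forall>v. v \<notin> V \<longrightarrow> f v = 0) \<and> (\<lambda>v. (cmod (f v))\<^sup>2) summable_on V}"

definition ell2_inner :: "'a set \<Rightarrow> ('a \<Rightarrow> complex) \<Rightarrow> ('a \<Rightarrow> complex) \<Rightarrow> complex" where
  "ell2_inner V f g = (\<Sum>\<^sub>\<infinity>v\<in>V. f v * cnj (g v))"

definition ell2_norm :: "'a set \<Rightarrow> ('a \<Rightarrow> complex) \<Rightarrow> real" where
  "ell2_norm V f = sqrt (\<Sum>\<^sub>\<infinity>v\<in>V. (cmod (f v))\<^sup>2)"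

definition basis_vec :: "'a \<Rightarrow> 'a \<Rightarrow> complex" where
  "basis_vec u = indicator {u}"

section \<open>Unbounded operators\<close>

text \<open>
  An operator in \<open>ell2 V\<close> is a partial map: its domain is \<^const>\<open>dom\<close>, its value at a vector \<open>f\<close> of
  the domain is \<open>the (A f)\<close>, equality of operators includes equality of domains, and the product
  of \<open>A\<close> and \<open>B\<close> with its natural domain is \<open>A \<circ>\<^sub>m B\<close>.
\<close>

type_synonym 'a oper = "('a \<Rightarrow> complex) \<rightharpoonup> ('a \<Rightarrow> complex)"

definition linear_oper :: "'a set \<Rightarrow> 'a oper \<Rightarrow> bool" where
  "linear_oper V A \<longleftrightarrow>
     dom A \<noteq> {} \<and> dom A \<subseteq> ell2 V \<and> ran A \<subseteq> ell2 V \<and>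
     (\<forall>f\<in>dom A. \<forall>g\<in>dom A. \<forall>a b.
        A (\<lambda>v. a * f v + b * g v) = Some (\<lambda>v. a * the (A f) v + b * the (A g) v))"

definition densely_defined :: "'a set \<Rightarrow> 'a oper \<Rightarrow> bool" where
  "densely_defined V A \<longleftrightarrow>
     (\<forall>f\<in>ell2 V. \<forall>\<epsilon>>0. \<exists>g\<in>dom A. ell2_norm V (\<lambda>v. f v - g v) < \<epsilon>)"

definition closed_oper :: "'a set \<Rightarrow> 'a oper \<Rightarrow> bool" where
  "closed_oper V A \<longleftrightarrow>
     (\<forall>F. \<forall>f\<in>ell2 V. \<forall>h\<in>ell2 V.
        (\<forall>n::nat. F n \<in> dom A) \<longrightarrow>
        (\<lambda>n. ell2_norm V (\<lambda>v. F n v - f v)) \<longlonglongrightarrow> 0 \<longrightarrow>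
        (\<lambda>n. ell2_norm V (\<lambda>v. the (A (F n)) v - h v)) \<longlonglongrightarrow> 0 \<longrightarrow>
        A f = Some h)"

text \<open>The vector \<open>h\<close> below is unique, hence the adjoint meaningful, when \<open>A\<close> is densely defined.\<close>

definition adjoint_oper :: "'a set \<Rightarrow> 'a oper \<Rightarrow> 'a oper" where
  "adjoint_oper V A = (\<lambda>g.
     if g \<in> ell2 V \<and>
        (\<exists>h\<in>ell2 V. \<forall>f\<in>dom A. ell2_inner V (the (A f)) g = ell2_inner V f h)
     then Some (THE h. h \<in> ell2 V \<and>
        (\<forall>f\<in>dom A. ell2_inner V (the (A f)) g = ell2_inner V f h))
     else None)"

definition positive_selfadjoint :: "'a set \<Rightarrow> 'a oper \<Rightarrow> bool" where
  "positive_selfadjoint V T \<longleftrightarrow>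
     linear_oper V T \<and> densely_defined V T \<and> adjoint_oper V T = T \<and>
     (\<forall>f\<in>dom T. Im (ell2_inner V (the (T f)) f) = 0 \<and> 0 \<le> Re (ell2_inner V (the (T f)) f))"

definition oper_sqrt :: "'a set \<Rightarrow> 'a oper \<Rightarrow> 'a oper" where
  "oper_sqrt V B = (THE T. positive_selfadjoint V T \<and> T \<circ>\<^sub>m T = B)"

definition modulus :: "'a set \<Rightarrow> 'a oper \<Rightarrow> 'a oper" where
  "modulus V A = oper_sqrt V (adjoint_oper V A \<circ>\<^sub>m A)"

section \<open>Spectral measures on the nonnegative half-line\<close>

abbreviation borel_Rplus :: "real measure" where
  "borel_Rplus \<equiv> restrict_space borel {0..}"

definition orth_projection :: "'a set \<Rightarrow> 'a oper \<Rightarrow> bool" where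
  "orth_projection V P \<longleftrightarrow>
     linear_oper V P \<and> dom P = ell2 V \<and> P \<circ>\<^sub>m P = P \<and> adjoint_oper V P = P"

text \<open>
  The number \<open>\<langle>E(\<sigma>)h,h\<rangle>\<close>. It is real and nonnegative when \<open>E(\<sigma>)\<close> is an orthogonal projection.
\<close>

definition spectral_form :: "'a set \<Rightarrow> (real set \<Rightarrow> 'a oper) \<Rightarrow> ('a \<Rightarrow> complex) \<Rightarrow> real set \<Rightarrow> real" where
  "spectral_form V E h \<sigma> = Re (ell2_inner V (the (E \<sigma> h)) h)"

definition spectral_form_measure :: "'a set \<Rightarrow> (real set \<Rightarrow> 'a oper) \<Rightarrow> ('a \<Rightarrow> complex) \<Rightarrow> real measure" where
  "spectral_form_measure V E h =
     measure_of {0..} (sets borel_Rplus) (\<lambda>\<sigma>. ennreal (spectral_form V E h \<sigma>))"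

text \<open>
  For projection-valued set functions, countable additivity of all the forms \<open>\<langle>E(\<cdot>)h,h\<rangle>\<close> is the
  usual countable additivity in the weak, equivalently strong, operator topology. The extensional
  function space only fixes the irrelevant values of \<open>E\<close> at sets that are not Borel.
\<close>

definition projection_valued_measure :: "'a set \<Rightarrow> (real set \<Rightarrow> 'a oper) \<Rightarrow> bool" where
  "projection_valued_measure V E \<longleftrightarrow>
     E \<in> sets borel_Rplus \<rightarrow>\<^sub>E {P. orth_projection V P} \<and>
     E {0..} = Some |` ell2 V \<and>
     (\<forall>h\<in>ell2 V. countably_additive (sets borel_Rplus) (\<lambda>\<sigma>. ennreal (spectral_form V E h \<sigma>)))"

text \<open>
  \<open>T\<close> is the spectral integral of the identity function with respect to \<open>E\<close>; by polarization the
  quadratic form determines the linear operator \<open>T\<close> on its domain.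
\<close>

definition is_spectral_measure_of :: "'a set \<Rightarrow> (real set \<Rightarrow> 'a oper) \<Rightarrow> 'a oper \<Rightarrow> bool" where
  "is_spectral_measure_of V E T \<longleftrightarrow>
     projection_valued_measure V E \<and>
     dom T = {f \<in> ell2 V. (\<integral>\<^sup>+ x. ennreal (x\<^sup>2) \<partial>spectral_form_measure V E f) < \<infinity>} \<and>
     (\<forall>f\<in>dom T. ell2_inner V (the (T f)) f = of_real (\<integral> x. x \<partial>spectral_form_measure V E f))"

definition spectral_measure :: "'a set \<Rightarrow> 'a oper \<Rightarrow> (real set \<Rightarrow> 'a oper)" where
  "spectral_measure V T = (THE E. is_spectral_measure_of V E T)"

section \<open>Weakly quasinormal operators\<close>

definition wqn_bound :: "'a set \<Rightarrow> 'a oper \<Rightarrow> real \<Rightarrow> bool" where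
  "wqn_bound V A c \<longleftrightarrow> 0 \<le> c \<and>
     (\<forall>\<sigma>\<in>sets borel_Rplus. \<forall>f\<in>dom A.
        spectral_form V (spectral_measure V (modulus V A)) (the (modulus V A f)) \<sigma>
          \<le> c * spectral_form V (spectral_measure V (modulus V A)) (the (A f)) \<sigma>)"

definition weakly_quasinormal :: "'a set \<Rightarrow> 'a oper \<Rightarrow> bool" where
  "weakly_quasinormal V A \<longleftrightarrow>
     linear_oper V A \<and> closed_oper V A \<and> densely_defined V A \<and> (\<exists>c. wqn_bound V A c)"

definition wqn_const :: "'a set \<Rightarrow> 'a oper \<Rightarrow> real" where
  "wqn_const V A = (LEAST c. wqn_bound V A c)"

section \<open>Weighted shifts on directed trees\<close>

text \<open>Only the values of the weight function \<open>lam\<close> on \<open>nonroots V Ed\<close> matter.\<close>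

definition shift_fun ::
    "'a set \<Rightarrow> ('a \<times> 'a) set \<Rightarrow> ('a \<Rightarrow> complex) \<Rightarrow> ('a \<Rightarrow> complex) \<Rightarrow> ('a \<Rightarrow> complex)" where
  "shift_fun V Ed lam f = (\<lambda>v. if v \<in> nonroots V Ed then lam v * f (par Ed v) else 0)"

definition weighted_shift :: "'a set \<Rightarrow> ('a \<times> 'a) set \<Rightarrow> ('a \<Rightarrow> complex) \<Rightarrow> 'a oper" where
  "weighted_shift V Ed lam =
     (\<lambda>f. Some (shift_fun V Ed lam f)) |` {f \<in> ell2 V. shift_fun V Ed lam f \<in> ell2 V}"

definition Chi_e :: "'a set \<Rightarrow> ('a \<times> 'a) set \<Rightarrow> ('a \<Rightarrow> complex) \<Rightarrow> 'a \<Rightarrow> 'a set" where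
  "Chi_e V Ed lam u =
     {v \<in> Chi V Ed u.
        ell2_norm V (the (weighted_shift V Ed lam (basis_vec v)))
          = ell2_norm V (the (weighted_shift V Ed lam (basis_vec u)))}"

definition Chi' :: "'a set \<Rightarrow> ('a \<times> 'a) set \<Rightarrow> ('a \<Rightarrow> complex) \<Rightarrow> 'a \<Rightarrow> 'a set" where
  "Chi' V Ed lam u = {v \<in> Chi_e V Ed lam u. lam v \<noteq> 0}"

end

(* The modulus |S| is the multiplication operator by d u = norm (S e_u): S* S multiplies by (d u)^2,
   as Chi u, u in V, partition the non-root vertices, and a positive square root of a diagonal operator
   is diagonal. Hence E(sigma) multiplies by the indicator of {u. d u : sigma}, and grouping by
   parents gives
     <E(sigma) |S| f, |S| f> = sum over u with d u in sigma of (d u)^2 |f u|^2,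
     <E(sigma) S f, S f> = sum over all u of |f u|^2 * (sum of |lam v|^2 over v in Chi u with d v in sigma).
   Taking f = e_u and sigma = {d u} yields the necessity of both conditions; they are sufficient
   because the summands can be compared for each u separately. *)

theory Submission
  imports Defs
begin

section \<open>Square summable functions\<close>

text \<open>\<open>modulus\<close> and \<open>spectral_measure\<close> are definite descriptions, so
  each explicit formula needs existence and uniqueness among all positive selfadjoint square roots,
  or all projection-valued measures representing the operator. Both uniqueness proofs use that every
  basis vector e_u is an eigenvector; symmetry then carries the result to arbitrary f
  coordinatewise, through (A f)(u) = <f, A e_u>. For the spectral measure the obstacle is how little
  ties a competitor E to the operator: the domain, the quadratic form, and countable additivity of
  the forms. Compatibility of E with intersections is not in the definition and is first recovered
  from additivity. The other obstacle is domains, since equality of partial maps includes them.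
  Grouping nonnegative sums by parents shows that S and multiplication by d have the same domain.
  Density of that domain enters twice: it makes the weights on each set of children square summable,
  so that every e_u lies in the domain, and it makes the diagonal operator densely defined. Finally
  \<open>wqn_const\<close> is a \<open>LEAST\<close> over the reals, which is meaningful because the
  set of admissible constants is closed.\<close>

lemma ell2_summable: "f \<in> ell2 V \<Longrightarrow> (\<lambda>v. (cmod (f v))\<^sup>2) summable_on V"
  by (simp add: ell2_def)

lemma ell2_zero_outside: "f \<in> ell2 V \<Longrightarrow> v \<notin> V \<Longrightarrow> f v = 0"
  by (simp add: ell2_def)

lemma ell2_I:
  assumes "\<And>v. v \<notin> V \<Longrightarrow> f v = 0" and "(\<lambda>v. (cmod (f v))\<^sup>2) summable_on V"
  shows "f \<in> ell2 V"
  using assms by (simp add: ell2_def)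

lemma ell2_dominated:
  assumes "g summable_on V" and "\<And>v. v \<notin> V \<Longrightarrow> f v = 0"
    and "\<And>v. v \<in> V \<Longrightarrow> (cmod (f v))\<^sup>2 \<le> g v"
  shows "f \<in> ell2 V"
  by (rule ell2_I) (auto intro!: summable_on_comparison_test[OF assms(1)] assms)

lemma ell2_zero [simp]: "(\<lambda>v. 0) \<in> ell2 V"
  by (simp add: ell2_def)

lemma ell2_scale: "f \<in> ell2 V \<Longrightarrow> (\<lambda>v. a * f v) \<in> ell2 V"
  by (auto simp: ell2_def norm_mult power_mult_distrib intro: summable_on_cmult_right)

lemma ell2_add:
  assumes "f \<in> ell2 V" "g \<in> ell2 V"
  shows "(\<lambda>v. f v + g v) \<in> ell2 V"
proof (rule ell2_dominated)
  show "(\<lambda>v. 2 * (cmod (f v))\<^sup>2 + 2 * (cmod (g v))\<^sup>2) summable_on V"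
    using assms by (intro summable_on_add summable_on_cmult_right ell2_summable)
  fix v
  have "(cmod (f v + g v))\<^sup>2 \<le> (cmod (f v) + cmod (g v))\<^sup>2"
    by (intro power_mono norm_triangle_ineq) auto
  also have "\<dots> \<le> 2 * (cmod (f v))\<^sup>2 + 2 * (cmod (g v))\<^sup>2"
    using sum_squares_bound[of "cmod (f v)" "cmod (g v)"] by (simp add: power2_sum)
  finally show "(cmod (f v + g v))\<^sup>2 \<le> 2 * (cmod (f v))\<^sup>2 + 2 * (cmod (g v))\<^sup>2" .
qed (use assms in \<open>auto simp: ell2_def\<close>)

lemma ell2_lincomb: "f \<in> ell2 V \<Longrightarrow> g \<in> ell2 V \<Longrightarrow> (\<lambda>v. a * f v + b * g v) \<in> ell2 V"
  by (intro ell2_add ell2_scale)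

lemma ell2_diff: "f \<in> ell2 V \<Longrightarrow> g \<in> ell2 V \<Longrightarrow> (\<lambda>v. f v - g v) \<in> ell2 V"
  using ell2_lincomb[of f V g 1 "-1"] by simp

lemma ell2_inner_abs_summable:
  assumes "f \<in> ell2 V" "g \<in> ell2 V"
  shows "(\<lambda>v. norm (f v * cnj (g v))) summable_on V"
proof (rule summable_on_comparison_test)
  show "(\<lambda>v. (cmod (f v))\<^sup>2 + (cmod (g v))\<^sup>2) summable_on V"
    using assms by (intro summable_on_add ell2_summable)
  fix v
  have "2 * cmod (f v) * cmod (g v) \<le> (cmod (f v))\<^sup>2 + (cmod (g v))\<^sup>2"
    by (rule sum_squares_bound)
  moreover have "0 \<le> cmod (f v) * cmod (g v)" by simp
  ultimately have "cmod (f v) * cmod (g v) \<le> (cmod (f v))\<^sup>2 + (cmod (g v))\<^sup>2" by linarith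
  then show "norm (f v * cnj (g v)) \<le> (cmod (f v))\<^sup>2 + (cmod (g v))\<^sup>2"
    by (simp add: norm_mult)
qed auto

lemma ell2_inner_summable:
  "f \<in> ell2 V \<Longrightarrow> g \<in> ell2 V \<Longrightarrow> (\<lambda>v. f v * cnj (g v)) summable_on V"
  by (rule abs_summable_summable) (rule ell2_inner_abs_summable)

lemma ell2_inner_lincomb_left:
  assumes "f \<in> ell2 V" "g \<in> ell2 V" "h \<in> ell2 V"
  shows "ell2_inner V (\<lambda>v. a * f v + b * g v) h = a * ell2_inner V f h + b * ell2_inner V g h"
proof -
  have "ell2_inner V (\<lambda>v. a * f v + b * g v) h
      = (\<Sum>\<^sub>\<infinity>v\<in>V. a * (f v * cnj (h v)) + b * (g v * cnj (h v)))"
    by (simp add: ell2_inner_def algebra_simps)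
  also have "\<dots> = (\<Sum>\<^sub>\<infinity>v\<in>V. a * (f v * cnj (h v))) + (\<Sum>\<^sub>\<infinity>v\<in>V. b * (g v * cnj (h v)))"
    using assms by (intro infsum_add summable_on_cmult_right ell2_inner_summable)
  also have "\<dots> = a * ell2_inner V f h + b * ell2_inner V g h"
    by (simp add: ell2_inner_def infsum_cmult_right')
  finally show ?thesis .
qed

lemma ell2_inner_diff_left:
  assumes "f \<in> ell2 V" "g \<in> ell2 V" "h \<in> ell2 V"
  shows "ell2_inner V (\<lambda>v. f v - g v) h = ell2_inner V f h - ell2_inner V g h"
  using ell2_inner_lincomb_left[OF assms, of 1 "-1"] by simp

lemma ell2_inner_cnj: "ell2_inner V g f = cnj (ell2_inner V f g)"
  unfolding ell2_inner_def by (subst infsum_cnj[symmetric]) (simp add: mult.commute)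

lemma ell2_inner_diff_right:
  assumes "f \<in> ell2 V" "g \<in> ell2 V" "h \<in> ell2 V"
  shows "ell2_inner V h (\<lambda>v. f v - g v) = ell2_inner V h f - ell2_inner V h g"
  using ell2_inner_diff_left[OF assms] ell2_inner_cnj by (metis complex_cnj_diff)

text \<open>Summability is not assumed: taking real parts shows that the two families are summable
  together, and otherwise both sums take the default value 0.\<close>

lemma infsum_complex_of_real: "(\<Sum>\<^sub>\<infinity>x\<in>A. complex_of_real (f x)) = of_real (infsum f A)"
proof (cases "f summable_on A")
  case True
  then show ?thesis
    by (intro infsumI has_sum_of_real has_sum_infsum)
next
  case False
  then have "\<not> (\<lambda>x. complex_of_real (f x)) summable_on A"
    using summable_on_Re[of "\<lambda>x. complex_of_real (f x)" A] by auto
  with False show ?thesis by (simp add: infsum_not_exists)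
qed

lemma ell2_inner_self: "ell2_inner V f f = of_real (\<Sum>\<^sub>\<infinity>v\<in>V. (cmod (f v))\<^sup>2)"
  by (simp add: ell2_inner_def complex_norm_square[symmetric] infsum_complex_of_real[symmetric]
      del: of_real_power)

lemma ell2_norm_power2: "(ell2_norm V f)\<^sup>2 = (\<Sum>\<^sub>\<infinity>v\<in>V. (cmod (f v))\<^sup>2)"
  by (simp add: ell2_norm_def infsum_nonneg)

lemma ell2_norm_nonneg: "0 \<le> ell2_norm V f"
  by (simp add: ell2_norm_def infsum_nonneg)

lemma ell2_inner_self_le_0D:
  assumes "f \<in> ell2 V" "Re (ell2_inner V f f) \<le> 0"
  shows "f = (\<lambda>v. 0)"
proof
  fix v
  have "(\<Sum>\<^sub>\<infinity>v\<in>V. (cmod (f v))\<^sup>2) \<le> 0"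
    using assms(2) by (simp add: ell2_inner_self)
  then show "f v = 0"
    using nonneg_infsum_le_0D[of "\<lambda>v. (cmod (f v))\<^sup>2" V v] assms(1)
    by (cases "v \<in> V") (auto simp: ell2_def)
qed

lemma basis_vec_apply: "basis_vec u v = (if v = u then 1 else 0)"
  by (simp add: basis_vec_def indicator_def)

lemma basis_vec_ell2: "u \<in> V \<Longrightarrow> basis_vec u \<in> ell2 V"
  by (rule ell2_I) (auto simp: basis_vec_apply intro!: finite_nonzero_values_imp_summable_on)

lemma infsum_single:
  fixes f :: "'a \<Rightarrow> 'b :: {comm_monoid_add, t2_space}"
  assumes "u \<in> V" "\<And>v. v \<in> V \<Longrightarrow> v \<noteq> u \<Longrightarrow> f v = 0"
  shows "infsum f V = f u"
  using infsum_cong_neutral[of "{u}" V f f] assms by auto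

lemma ell2_inner_basis_right: "u \<in> V \<Longrightarrow> ell2_inner V f (basis_vec u) = f u"
  by (simp add: ell2_inner_def basis_vec_apply infsum_single[of u])

lemma ell2_inner_basis_left: "u \<in> V \<Longrightarrow> ell2_inner V (basis_vec u) f = cnj (f u)"
  by (simp add: ell2_inner_def basis_vec_apply infsum_single[of u])

lemma ell2_eqI:
  assumes "f \<in> ell2 V" "g \<in> ell2 V" "\<And>v. v \<in> V \<Longrightarrow> f v = g v"
  shows "f = g"
  using assms by (metis ell2_zero_outside ext)

lemma cmod_le_ell2_norm:
  assumes "f \<in> ell2 V" "u \<in> V"
  shows "cmod (f u) \<le> ell2_norm V f"
proof -
  have "(\<Sum>v\<in>{u}. (cmod (f v))\<^sup>2) \<le> (\<Sum>\<^sub>\<infinity>v\<in>V. (cmod (f v))\<^sup>2)"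
    using assms by (intro finite_sum_le_infsum ell2_summable) auto
  then have "(cmod (f u))\<^sup>2 \<le> (ell2_norm V f)\<^sup>2"
    by (simp add: ell2_norm_power2)
  then show ?thesis
    using ell2_norm_nonneg by (rule power2_le_imp_le)
qed

text \<open>Coordinate functionals are bounded by the norm. This is the form in which convergence in
  the closedness proof is used.\<close>

lemma ell2_norm_tendsto_pointwise:
  assumes "(\<lambda>n. ell2_norm V (\<lambda>v. F n v - f v)) \<longlonglongrightarrow> 0" "\<And>n. F n \<in> ell2 V" "f \<in> ell2 V"
  shows "(\<lambda>n. F n u) \<longlonglongrightarrow> f u"
proof (cases "u \<in> V")
  case True
  have "(\<lambda>n. F n u - f u) \<longlonglongrightarrow> 0"
  proof (rule Lim_null_comparison[OF _ assms(1)])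
    show "\<forall>\<^sub>F n in sequentially. norm (F n u - f u) \<le> ell2_norm V (\<lambda>v. F n v - f v)"
      using cmod_le_ell2_norm[OF ell2_diff[OF assms(2,3)] True] by simp
  qed
  then show ?thesis by (simp add: LIM_zero_iff)
next
  case False
  then have "F n u = 0" "f u = 0" for n
    using ell2_zero_outside[OF assms(2)] ell2_zero_outside[OF assms(3)] by auto
  then show ?thesis by simp
qed

text \<open>Testing against the basis vectors makes the vector in the definition of the adjoint unique.\<close>

lemma adjoint_oper_eq_Some_iff:
  assumes "\<And>u. u \<in> V \<Longrightarrow> basis_vec u \<in> dom A"
  shows "adjoint_oper V A g = Some h \<longleftrightarrow>
    g \<in> ell2 V \<and> h \<in> ell2 V \<and> (\<forall>f\<in>dom A. ell2_inner V (the (A f)) g = ell2_inner V f h)"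
    (is "_ \<longleftrightarrow> g \<in> ell2 V \<and> ?P h")
proof -
  have uniq: "h1 = h2" if "?P h1" "?P h2" for h1 h2
  proof (rule ell2_eqI)
    fix u assume "u \<in> V"
    then have "ell2_inner V (basis_vec u) h1 = ell2_inner V (basis_vec u) h2"
      using that assms by metis
    then show "h1 u = h2 u"
      using \<open>u \<in> V\<close> by (simp add: ell2_inner_basis_left)
  qed (use that in auto)
  have the: "(THE h. ?P h) = h'" if "?P h'" for h'
    using that uniq by (intro the_equality) blast+
  show ?thesis
  proof (cases "g \<in> ell2 V \<and> (\<exists>h. ?P h)")
    case True
    then obtain h' where h': "?P h'" by blast
    have "adjoint_oper V A g = Some (THE h. ?P h)"
      using True by (simp only: adjoint_oper_def Bex_def simp_thms if_True)
    also have "\<dots> = Some h'" using the[OF h'] by (rule arg_cong)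
    finally show ?thesis using True h' uniq by (metis option.inject)
  next
    case False
    then have "adjoint_oper V A g = None"
      by (simp only: adjoint_oper_def Bex_def if_False simp_thms)
    with False show ?thesis by (metis option.distinct(1))
  qed
qed

section \<open>Diagonal operators\<close>

text \<open>Multiplication by a real function on its maximal domain. Maximality is what makes this
  operator equal to its adjoint and not merely symmetric.\<close>

definition diag_oper :: "'a set \<Rightarrow> ('a \<Rightarrow> real) \<Rightarrow> 'a oper" where
  "diag_oper V m = (\<lambda>f. Some (\<lambda>v. of_real (m v) * f v)) |`
     {f \<in> ell2 V. (\<lambda>v. of_real (m v) * f v) \<in> ell2 V}"

lemma dom_diag_oper: "dom (diag_oper V m) = {f \<in> ell2 V. (\<lambda>v. of_real (m v) * f v) \<in> ell2 V}"
  by (auto simp: diag_oper_def restrict_map_def split: if_splits)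

lemma diag_oper_eq_Some_iff:
  "diag_oper V m f = Some h \<longleftrightarrow> f \<in> ell2 V \<and> h \<in> ell2 V \<and> h = (\<lambda>v. of_real (m v) * f v)"
  by (auto simp: diag_oper_def restrict_map_def)

lemma the_diag_oper: "f \<in> dom (diag_oper V m) \<Longrightarrow> the (diag_oper V m f) = (\<lambda>v. of_real (m v) * f v)"
  unfolding dom_diag_oper by (simp add: diag_oper_def)

lemma basis_vec_dom_diag: "u \<in> V \<Longrightarrow> basis_vec u \<in> dom (diag_oper V m)"
proof -
  assume u: "u \<in> V"
  have "(\<lambda>v. of_real (m v) * basis_vec u v) = (\<lambda>v. of_real (m u) * basis_vec u v)"
    by (auto simp: basis_vec_apply)
  then show ?thesis
    using u by (simp add: dom_diag_oper basis_vec_ell2 ell2_scale)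
qed

lemma linear_diag_oper: "linear_oper V (diag_oper V m)"
proof -
  have "dom (diag_oper V m) \<noteq> {}"
    using ell2_zero[of V] by (auto simp: dom_diag_oper simp del: domIff intro!: exI[of _ "\<lambda>v. 0"])
  moreover have "dom (diag_oper V m) \<subseteq> ell2 V" "ran (diag_oper V m) \<subseteq> ell2 V"
    by (auto simp: ran_def diag_oper_eq_Some_iff)
  moreover have "diag_oper V m (\<lambda>v. a * f v + b * g v)
      = Some (\<lambda>v. a * the (diag_oper V m f) v + b * the (diag_oper V m g) v)"
    if "f \<in> dom (diag_oper V m)" "g \<in> dom (diag_oper V m)" for f g a b
  proof -
    have "(\<lambda>v. a * (of_real (m v) * f v) + b * (of_real (m v) * g v)) \<in> ell2 V"
      using that by (intro ell2_lincomb) (auto simp: dom_diag_oper)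
    then show ?thesis
      using that ell2_lincomb[of f V g a b]
      by (auto simp: diag_oper_eq_Some_iff the_diag_oper dom_diag_oper algebra_simps simp del: domIff)
  qed
  ultimately show ?thesis
    unfolding linear_oper_def by blast
qed

text \<open>Testing the adjoint relation on basis vectors forces h = m g, and membership of h in
  \<open>ell2 V\<close> then puts g into the maximal domain. Conversely a real multiplier moves
  across the inner product.\<close>

lemma adjoint_diag_oper: "adjoint_oper V (diag_oper V m) = diag_oper V m"
proof -
  have "adjoint_oper V (diag_oper V m) g = Some h \<longleftrightarrow> diag_oper V m g = Some h" for g h
  proof
    assume "adjoint_oper V (diag_oper V m) g = Some h"
    then have g: "g \<in> ell2 V" and h: "h \<in> ell2 V" and
      adj: "\<And>f. f \<in> dom (diag_oper V m) \<Longrightarrow>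
        ell2_inner V (\<lambda>v. of_real (m v) * f v) g = ell2_inner V f h"
      by (auto simp: adjoint_oper_eq_Some_iff[OF basis_vec_dom_diag] the_diag_oper)
    have "h u = of_real (m u) * g u" for u
    proof (cases "u \<in> V")
      case True
      \<comment> \<open>The summand \<open>0 * g v\<close> only brings the function into the shape
        of \<open>ell2_inner_lincomb_left\<close>.\<close>
      have "(\<lambda>v. of_real (m v) * basis_vec u v) = (\<lambda>v. of_real (m u) * basis_vec u v + 0 * g v)"
        by (auto simp: basis_vec_apply)
      then have "of_real (m u) * cnj (g u) = cnj (h u)"
        using adj[OF basis_vec_dom_diag[OF True]] True g
          ell2_inner_lincomb_left[OF basis_vec_ell2[OF True] g g, of "of_real (m u)" 0]
        by (simp add: ell2_inner_basis_left)
      then show ?thesis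
        by (metis complex_cnj_cnj complex_cnj_complex_of_real complex_cnj_mult)
    qed (use g h in \<open>auto simp: ell2_def\<close>)
    then show "diag_oper V m g = Some h"
      using g h by (auto simp: diag_oper_eq_Some_iff)
  next
    assume "diag_oper V m g = Some h"
    then show "adjoint_oper V (diag_oper V m) g = Some h"
      by (auto simp: adjoint_oper_eq_Some_iff[OF basis_vec_dom_diag] the_diag_oper
          diag_oper_eq_Some_iff ell2_inner_def algebra_simps)
  qed
  then show ?thesis
    by (intro ext) (metis option.exhaust)
qed

text \<open>The point is the domain: the product also requires m f to be square summable. This
  follows from f and m^2 f being so, because m^2 <= 1 + m^4.\<close>

lemma diag_oper_comp_self: "diag_oper V m \<circ>\<^sub>m diag_oper V m = diag_oper V (\<lambda>v. (m v)\<^sup>2)"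
proof -
  have sq: "(\<lambda>v. of_real ((m v)\<^sup>2) * f v) = (\<lambda>v. of_real (m v) * (of_real (m v) * f v))"
    for f :: "'a \<Rightarrow> complex"
    by (simp add: power2_eq_square mult.assoc)
  have "(\<lambda>v. of_real (m v) * f v) \<in> ell2 V"
    if f: "f \<in> ell2 V" "(\<lambda>v. of_real ((m v)\<^sup>2) * f v) \<in> ell2 V" for f :: "'a \<Rightarrow> complex"
  proof (rule ell2_dominated)
    show "(\<lambda>v. (cmod (f v))\<^sup>2 + (cmod (of_real ((m v)\<^sup>2) * f v))\<^sup>2) summable_on V"
      using f by (intro summable_on_add ell2_summable)
    fix v
    have "(m v)\<^sup>2 \<le> 1 + ((m v)\<^sup>2)\<^sup>2"
      using sum_squares_bound[of "(m v)\<^sup>2" 1] zero_le_power2[of "m v"] unfolding one_power2 by linarith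
    then have "(m v)\<^sup>2 * (cmod (f v))\<^sup>2 \<le> (1 + ((m v)\<^sup>2)\<^sup>2) * (cmod (f v))\<^sup>2"
      by (rule mult_right_mono) simp
    then show "(cmod (of_real (m v) * f v))\<^sup>2 \<le> (cmod (f v))\<^sup>2 + (cmod (of_real ((m v)\<^sup>2) * f v))\<^sup>2"
      by (simp add: norm_mult power_mult_distrib distrib_right norm_power del: of_real_power)
  qed (use f in \<open>auto simp: ell2_def\<close>)
  then have "(diag_oper V m \<circ>\<^sub>m diag_oper V m) f = Some h \<longleftrightarrow> diag_oper V (\<lambda>v. (m v)\<^sup>2) f = Some h"
    for f h
    by (auto simp: map_comp_Some_iff diag_oper_eq_Some_iff sq simp del: of_real_power)
  then show ?thesis
    by (intro ext) (metis option.exhaust)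
qed

lemma positive_selfadjoint_diag_oper:
  assumes "\<And>v. v \<in> V \<Longrightarrow> 0 \<le> m v" "densely_defined V (diag_oper V m)"
  shows "positive_selfadjoint V (diag_oper V m)"
proof -
  have "ell2_inner V (\<lambda>v. of_real (m v) * f v) f = of_real (\<Sum>\<^sub>\<infinity>v\<in>V. m v * (cmod (f v))\<^sup>2)" for f
    by (simp add: ell2_inner_def complex_norm_square[symmetric] infsum_complex_of_real[symmetric] mult.assoc
      del: of_real_power)
  then show ?thesis
    using assms
    by (auto simp: positive_selfadjoint_def linear_diag_oper adjoint_diag_oper the_diag_oper
        intro!: infsum_nonneg)
qed

text \<open>On a basis vector \<open>e\<close> with eigenvalue \<open>d = m u\<close> a positive square root satisfies
  \<open>(T + d) (T - d) e = 0\<close>, and \<open>T + d\<close> is injective for \<open>d > 0\<close>.\<close>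

lemma positive_sqrt_diag_unique:
  assumes nonneg: "\<And>v. v \<in> V \<Longrightarrow> 0 \<le> m v" and T: "positive_selfadjoint V T"
    and TT: "T \<circ>\<^sub>m T = diag_oper V (\<lambda>v. (m v)\<^sup>2)"
  shows "T = diag_oper V m"
proof -
  have lin: "T (\<lambda>v. a * f v + b * g v) = Some (\<lambda>v. a * the (T f) v + b * the (T g) v)"
    if "f \<in> dom T" "g \<in> dom T" for f g a b
    using T that by (auto simp: positive_selfadjoint_def linear_oper_def)
  have adj: "adjoint_oper V T = T" and domT: "dom T \<subseteq> ell2 V" and ranT: "ran T \<subseteq> ell2 V"
    and pos: "\<And>f. f \<in> dom T \<Longrightarrow> 0 \<le> Re (ell2_inner V (the (T f)) f)"
    using T by (auto simp: positive_selfadjoint_def linear_oper_def)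
  \<comment> \<open>The basis vector lies in the domain of the product of T with itself, hence in
    that of T.\<close>
  have basis: "basis_vec u \<in> dom T" if u: "u \<in> V" for u
    using basis_vec_dom_diag[OF u, of "\<lambda>v. (m v)\<^sup>2"] TT[symmetric]
    by (auto simp: map_comp_Some_iff)
  have sym: "ell2_inner V (the (T f)) g = ell2_inner V f (the (T g))"
    if "f \<in> dom T" "g \<in> dom T" for f g
    using that adj adjoint_oper_eq_Some_iff[of V T g "the (T g)"] basis by auto
  have in_ell2: "the (T f) \<in> ell2 V" if "f \<in> dom T" for f
    using that ranT by (auto simp: ran_def)
  have eigen: "the (T (basis_vec u)) = (\<lambda>v. of_real (m u) * basis_vec u v)" if u: "u \<in> V" for u
  proof -
    let ?e = "basis_vec u" and ?d = "of_real (m u) :: complex"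
    obtain h where h: "T ?e = Some h" using basis[OF u] by auto
    have "(T \<circ>\<^sub>m T) ?e = Some (\<lambda>v. of_real ((m v)\<^sup>2) * ?e v)"
      unfolding TT using basis_vec_dom_diag[OF u, of "\<lambda>v. (m v)\<^sup>2"] by (auto simp: diag_oper_eq_Some_iff)
    also have "\<dots> = Some (\<lambda>v. ?d\<^sup>2 * ?e v)"
      by (auto simp: basis_vec_apply)
    finally have Th: "T h = Some (\<lambda>v. ?d\<^sup>2 * ?e v)"
      using h by (simp add: map_comp_def)
    have e2: "?e \<in> ell2 V" and h2: "h \<in> ell2 V" and hT: "h \<in> dom T" and eT: "?e \<in> dom T"
      using basis_vec_ell2[OF u] in_ell2[OF basis[OF u]] h Th by auto
    show ?thesis
    proof (cases "m u = 0")
      case True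
      have "ell2_inner V h h = ell2_inner V (the (T h)) ?e"
        using sym[OF hT eT] h by simp
      also have "\<dots> = 0"
        using Th True by (simp add: ell2_inner_def)
      finally have "h = (\<lambda>v. 0)"
        by (intro ell2_inner_self_le_0D[OF h2]) simp
      then show ?thesis using h True by simp
    next
      case False
      then have d: "0 < m u" using nonneg[OF u] by simp
      define g where "g = (\<lambda>v. 1 * h v + (- ?d) * ?e v)"
      have g2: "g \<in> ell2 V" unfolding g_def by (intro ell2_lincomb h2 e2)
      \<comment> \<open>Here T g = d^2 e - d (T e) = -d g, so positivity of <T g, g> leaves <g, g>
        <= 0.\<close>
      have Tg: "T g = Some (\<lambda>v. (- ?d) * g v + 0 * g v)"
        unfolding g_def using lin[OF hT eT, of 1 "- ?d"] h Th
        by (simp add: algebra_simps power2_eq_square)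
      have "0 \<le> Re (ell2_inner V (the (T g)) g)"
        using pos Tg by blast
      also have "ell2_inner V (the (T g)) g = - ?d * ell2_inner V g g"
        using ell2_inner_lincomb_left[OF g2 g2 g2, of "- ?d" 0] Tg by simp
      finally have "Re (ell2_inner V g g) \<le> 0"
        using d by (simp add: mult_le_0_iff)
      then have "g = (\<lambda>v. 0)" by (rule ell2_inner_self_le_0D[OF g2])
      then show ?thesis using h by (simp add: g_def fun_eq_iff)
    qed
  qed
  \<comment> \<open>Symmetry moves T onto the basis vector, which determines every coordinate of T
    f; thus T is a restriction of the diagonal operator.\<close>
  have sub: "diag_oper V m f = T f" if f: "f \<in> dom T" for f
  proof -
    have "the (T f) u = of_real (m u) * f u" for u
    proof (cases "u \<in> V")
      case True
      have "the (T f) u = ell2_inner V f (\<lambda>v. of_real (m u) * basis_vec u v)"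
        using sym[OF f basis[OF True]] eigen[OF True] True by (simp add: ell2_inner_basis_right)
      also have "\<dots> = of_real (m u) * f u"
        using True by (simp add: ell2_inner_def basis_vec_apply infsum_single[of u])
      finally show ?thesis .
    next
      case False
      then show ?thesis using f domT in_ell2[OF f] by (auto simp: ell2_def)
    qed
    then have "the (T f) = (\<lambda>u. of_real (m u) * f u)" ..
    then show ?thesis
      using f domT in_ell2[OF f] by (auto simp: diag_oper_eq_Some_iff)
  qed
  \<comment> \<open>Conversely, as T is a restriction of the symmetric diagonal operator, every f in
    the domain of the latter lies in the domain of the adjoint of T, which is T.\<close>
  have "f \<in> dom T" if f: "f \<in> dom (diag_oper V m)" for f
  proof -
    have "ell2_inner V (the (T g)) f = ell2_inner V g (the (diag_oper V m f))" if g: "g \<in> dom T" for g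
    proof -
      have "g \<in> dom (diag_oper V m)" using sub[OF g] g by (auto simp: dom_def)
      then have "the (T g) = (\<lambda>v. of_real (m v) * g v)"
        using sub[OF g] the_diag_oper by metis
      then show ?thesis
        using f by (simp add: the_diag_oper ell2_inner_def algebra_simps)
    qed
    then have "adjoint_oper V T f = Some (the (diag_oper V m f))"
      using f by (simp add: adjoint_oper_eq_Some_iff[OF basis] the_diag_oper) (simp add: dom_diag_oper)
    then show ?thesis using adj by auto
  qed
  then show ?thesis
    using sub by (intro ext) (metis domIff)
qed

lemma oper_sqrt_diag:
  assumes "\<And>v. v \<in> V \<Longrightarrow> 0 \<le> m v" "densely_defined V (diag_oper V m)"
  shows "oper_sqrt V (diag_oper V (\<lambda>v. (m v)\<^sup>2)) = diag_oper V m"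
  unfolding oper_sqrt_def
proof (rule the_equality)
  show "positive_selfadjoint V (diag_oper V m) \<and>
      diag_oper V m \<circ>\<^sub>m diag_oper V m = diag_oper V (\<lambda>v. (m v)\<^sup>2)"
    by (simp add: positive_selfadjoint_diag_oper[OF assms] diag_oper_comp_self)
qed (rule positive_sqrt_diag_unique, use assms(1) in auto)

section \<open>Projection-valued measures\<close>

text \<open>Links unordered sums with Lebesgue integrals: for real families summability is absolute
  summability, that is, integrability for the counting measure. The index set may be
  uncountable.\<close>

lemma nn_integral_count_space_infsum:
  assumes "\<And>x. x \<in> A \<Longrightarrow> 0 \<le> f x" and "f summable_on A"
  shows "(\<integral>\<^sup>+x. ennreal (f x) \<partial>count_space A) = ennreal (infsum f A)"
proof -
  have abs: "Infinite_Set_Sum.abs_summable_on f A"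
    using assms(2) unfolding abs_summable_equivalent[symmetric]
    by (rule summable_on_iff_abs_summable_on_real[THEN iffD1])
  then have "(\<integral>\<^sup>+x. ennreal (f x) \<partial>count_space A) = ennreal (infsetsum f A)"
    unfolding infsetsum_def abs_summable_on_def
    by (rule nn_integral_eq_integral) (simp add: AE_count_space assms(1))
  then show ?thesis using abs by (simp add: infsetsum_infsum)
qed

text \<open>Translates the finite second moment condition on spectral domains into membership in
  \<open>ell2 V\<close>.\<close>

lemma nn_integral_count_space_finite_iff_summable:
  fixes f :: "'a \<Rightarrow> real"
  assumes "\<And>x. x \<in> A \<Longrightarrow> 0 \<le> f x"
  shows "(\<integral>\<^sup>+x. ennreal (f x) \<partial>count_space A) < \<infinity> \<longleftrightarrow> f summable_on A"
proof
  assume "(\<integral>\<^sup>+x. ennreal (f x) \<partial>count_space A) < \<infinity>"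
  then have "integrable (count_space A) f"
    by (intro integrableI_nonneg) (auto simp: AE_count_space assms)
  then have "Infinite_Set_Sum.abs_summable_on f A"
    by (simp add: abs_summable_on_def)
  then show "f summable_on A"
    unfolding abs_summable_equivalent[symmetric]
    by (rule summable_on_iff_abs_summable_on_real[THEN iffD2])
next
  assume "f summable_on A"
  then show "(\<integral>\<^sup>+x. ennreal (f x) \<partial>count_space A) < \<infinity>"
    by (simp add: nn_integral_count_space_infsum assms)
qed

lemma sigma_algebra_borel_Rplus: "sigma_algebra {0..} (sets borel_Rplus)"
  using sets.sigma_algebra_axioms[of borel_Rplus] by simp

lemma sets_spectral_form_measure [simp]: "sets (spectral_form_measure V E h) = sets borel_Rplus"
  unfolding spectral_form_measure_def
  by (rule sigma_algebra.sets_measure_of_eq[OF sigma_algebra_borel_Rplus])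

lemma space_spectral_form_measure [simp]: "space (spectral_form_measure V E h) = {0..}"
  unfolding spectral_form_measure_def
  by (rule sigma_algebra.space_measure_of_eq[OF sigma_algebra_borel_Rplus])

lemma measurable_spectral_form_measure:
  "f \<in> borel_measurable borel \<Longrightarrow> f \<in> borel_measurable (spectral_form_measure V E h)"
  using measurable_restrict_space1[of f borel borel "{0..}"]
    measurable_cong_sets[OF sets_spectral_form_measure refl] by blast

section \<open>Orthogonal projections and their quadratic forms\<close>

context
  fixes V :: "'a set" and P :: "'a oper"
  assumes P: "orth_projection V P"
begin

lemma proj_dom: "dom P = ell2 V"
  using P by (simp add: orth_projection_def)

lemma proj_ell2: "f \<in> ell2 V \<Longrightarrow> the (P f) \<in> ell2 V"
proof -
  assume "f \<in> ell2 V"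
  then obtain g where "P f = Some g" using proj_dom by blast
  moreover have "ran P \<subseteq> ell2 V"
    using P unfolding orth_projection_def linear_oper_def by (elim conjE)
  ultimately show ?thesis using ranI[of P f g] by auto
qed

lemma proj_idem: "f \<in> ell2 V \<Longrightarrow> the (P (the (P f))) = the (P f)"
proof -
  assume "f \<in> ell2 V"
  then obtain g where "P f = Some g" using proj_dom by blast
  moreover have "(P \<circ>\<^sub>m P) f = P f" using P by (simp add: orth_projection_def)
  ultimately show ?thesis by (simp add: map_comp_def)
qed

lemma proj_sym:
  assumes "f \<in> ell2 V" "g \<in> ell2 V"
  shows "ell2_inner V (the (P f)) g = ell2_inner V f (the (P g))"
proof -
  obtain h where h: "P g = Some h" using assms proj_dom by blast
  then have "adjoint_oper V P g = Some h" using P by (simp add: orth_projection_def)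
  then show ?thesis
    using adjoint_oper_eq_Some_iff[of V P g h] assms h by (simp add: proj_dom basis_vec_ell2 del: domIff)
qed

lemma proj_diff:
  assumes "f \<in> ell2 V" "g \<in> ell2 V"
  shows "the (P (\<lambda>v. f v - g v)) = (\<lambda>v. the (P f) v - the (P g) v)"
proof -
  have "P (\<lambda>v. 1 * f v + (-1) * g v) = Some (\<lambda>v. 1 * the (P f) v + (-1) * the (P g) v)"
    using P assms unfolding orth_projection_def linear_oper_def by blast
  then show ?thesis by simp
qed

lemma proj_form: "f \<in> ell2 V \<Longrightarrow> ell2_inner V (the (P f)) f = ell2_inner V (the (P f)) (the (P f))"
  using proj_sym[of "the (P f)" f] by (simp add: proj_ell2 proj_idem)

lemma proj_form_eq_0D:
  "f \<in> ell2 V \<Longrightarrow> Re (ell2_inner V (the (P f)) f) = 0 \<Longrightarrow> the (P f) = (\<lambda>v. 0)"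
  by (rule ell2_inner_self_le_0D[of _ V]) (simp_all add: proj_ell2 proj_form)

text \<open>The residual f - P f is annihilated by P, so its squared norm equals <f, f> - <P f,
  f>.\<close>

lemma proj_eq_selfI:
  assumes f: "f \<in> ell2 V" and eq: "Re (ell2_inner V (the (P f)) f) = Re (ell2_inner V f f)"
  shows "the (P f) = f"
proof -
  let ?g = "\<lambda>v. f v - the (P f) v"
  have "ell2_inner V ?g ?g = ell2_inner V ?g f - ell2_inner V ?g (the (P f))"
    using f by (simp add: ell2_inner_diff_right proj_ell2 ell2_diff)
  also have "ell2_inner V ?g (the (P f)) = ell2_inner V (the (P ?g)) f"
    using f by (simp add: proj_sym proj_ell2 ell2_diff)
  also have "\<dots> = 0"
    using f by (simp add: proj_diff proj_ell2 proj_idem ell2_inner_def)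
  finally have "Re (ell2_inner V ?g ?g) = 0"
    using f eq by (simp add: ell2_inner_diff_left proj_ell2)
  then have "?g = (\<lambda>v. 0)"
    using f by (intro ell2_inner_self_le_0D[of _ V]) (simp_all add: proj_ell2 ell2_diff)
  then show ?thesis by (simp add: fun_eq_iff)
qed

end

section \<open>Projection-valued measures: intersections recovered from additivity\<close>

context
  fixes V :: "'a set" and E :: "real set \<Rightarrow> 'a oper"
  assumes pvm: "projection_valued_measure V E"
begin

lemma pvm_proj: "\<sigma> \<in> sets borel_Rplus \<Longrightarrow> orth_projection V (E \<sigma>)"
proof -
  assume "\<sigma> \<in> sets borel_Rplus"
  moreover have "E \<in> sets borel_Rplus \<rightarrow>\<^sub>E {P. orth_projection V P}"
    using pvm unfolding projection_valued_measure_def by (rule conjunct1)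
  ultimately have "E \<sigma> \<in> {P. orth_projection V P}" by (rule PiE_mem[rotated])
  then show ?thesis by (rule CollectD)
qed

lemma pvm_full: "f \<in> ell2 V \<Longrightarrow> the (E {0..} f) = f"
proof -
  assume "f \<in> ell2 V"
  moreover have "E {0..} = Some |` ell2 V"
    using pvm unfolding projection_valued_measure_def by (elim conjE)
  ultimately show ?thesis by simp
qed

lemma spectral_form_nonneg:
  assumes "h \<in> ell2 V" "\<sigma> \<in> sets borel_Rplus"
  shows "0 \<le> spectral_form V E h \<sigma>"
  unfolding spectral_form_def proj_form[OF pvm_proj[OF assms(2)] assms(1)] ell2_inner_self
  by (simp add: infsum_nonneg)

lemma pvm_eq_0D:
  "h \<in> ell2 V \<Longrightarrow> \<sigma> \<in> sets borel_Rplus \<Longrightarrow> spectral_form V E h \<sigma> = 0 \<Longrightarrow> the (E \<sigma> h) = (\<lambda>v. 0)"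
  unfolding spectral_form_def by (rule proj_form_eq_0D[OF pvm_proj])

text \<open>\<open>countably_additive\<close> does not prescribe the value at the empty set. With
  the constant sequence of empty sets the value a satisfies a + a <= a, and a is finite and
  nonnegative.\<close>

lemma spectral_form_empty: "h \<in> ell2 V \<Longrightarrow> spectral_form V E h {} = 0"
proof -
  assume h: "h \<in> ell2 V"
  let ?\<mu> = "\<lambda>\<sigma>. ennreal (spectral_form V E h \<sigma>)"
  have "countably_additive (sets borel_Rplus) ?\<mu>"
    using pvm h by (simp add: projection_valued_measure_def)
  from this[unfolded countably_additive_def, rule_format, of "\<lambda>i. {}"]
  have "(\<Sum>i::nat. ?\<mu> {}) = ?\<mu> {}"
    by (simp add: disjoint_family_on_def)
  moreover have "(\<Sum>i<(2::nat). ?\<mu> {}) \<le> (\<Sum>i::nat. ?\<mu> {})"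
    by (rule sum_le_suminf) auto
  ultimately have "?\<mu> {} + ?\<mu> {} \<le> ?\<mu> {}"
    by (simp add: mult_2)
  then have "spectral_form V E h {} + spectral_form V E h {} \<le> spectral_form V E h {}"
    using spectral_form_nonneg[OF h, of "{}"] by (simp flip: ennreal_plus)
  then show ?thesis
    using spectral_form_nonneg[OF h, of "{}"] by simp
qed

text \<open>\<open>measure_of\<close> keeps the given set function only if it really is a measure,
  so the value at the empty set and countable additivity must be supplied first.\<close>

lemma emeasure_spectral_form_measure:
  assumes "h \<in> ell2 V" "\<sigma> \<in> sets borel_Rplus"
  shows "emeasure (spectral_form_measure V E h) \<sigma> = ennreal (spectral_form V E h \<sigma>)"
proof -
  have "positive (sets borel_Rplus) (\<lambda>\<sigma>. ennreal (spectral_form V E h \<sigma>))"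
    by (simp add: positive_def spectral_form_empty[OF assms(1)])
  moreover have "countably_additive (sets borel_Rplus) (\<lambda>\<sigma>. ennreal (spectral_form V E h \<sigma>))"
    using pvm assms by (simp add: projection_valued_measure_def)
  ultimately show ?thesis
    unfolding spectral_form_measure_def
    using emeasure_measure_of_sigma[OF sigma_algebra_borel_Rplus _ _ assms(2)] by metis
qed

lemma finite_spectral_form_measure: "h \<in> ell2 V \<Longrightarrow> finite_measure (spectral_form_measure V E h)"
  using emeasure_spectral_form_measure[of h "{0..}"] sets.top[of borel_Rplus]
  by (intro finite_measureI) simp

lemma spectral_form_Un:
  assumes h: "h \<in> ell2 V" and \<sigma>: "\<sigma> \<in> sets borel_Rplus" and \<tau>: "\<tau> \<in> sets borel_Rplus"
    and disj: "\<sigma> \<inter> \<tau> = {}"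
  shows "spectral_form V E h (\<sigma> \<union> \<tau>) = spectral_form V E h \<sigma> + spectral_form V E h \<tau>"
proof -
  have Un: "\<sigma> \<union> \<tau> \<in> sets borel_Rplus" using \<sigma> \<tau> by (rule sets.Un)
  have "ennreal (spectral_form V E h (\<sigma> \<union> \<tau>))
      = ennreal (spectral_form V E h \<sigma>) + ennreal (spectral_form V E h \<tau>)"
    using plus_emeasure[of \<sigma> "spectral_form_measure V E h" \<tau>] assms Un
    by (simp add: emeasure_spectral_form_measure)
  then show ?thesis
    using assms Un by (simp add: spectral_form_nonneg flip: ennreal_plus)
qed

lemma spectral_form_mono:
  assumes h: "h \<in> ell2 V" and \<sigma>: "\<sigma> \<in> sets borel_Rplus" and \<tau>: "\<tau> \<in> sets borel_Rplus"
    and sub: "\<sigma> \<subseteq> \<tau>"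
  shows "spectral_form V E h \<sigma> \<le> spectral_form V E h \<tau>"
proof -
  have "\<sigma> \<union> (\<tau> - \<sigma>) = \<tau>" using sub by blast
  then have "spectral_form V E h \<tau> = spectral_form V E h \<sigma> + spectral_form V E h (\<tau> - \<sigma>)"
    using spectral_form_Un[OF h \<sigma> sets.Diff[OF \<tau> \<sigma>]] by simp
  then show ?thesis
    using spectral_form_nonneg[OF h sets.Diff[OF \<tau> \<sigma>]] by simp
qed

lemma spectral_form_full: "h \<in> ell2 V \<Longrightarrow> spectral_form V E h {0..} = Re (ell2_inner V h h)"
  by (simp add: spectral_form_def pvm_full)

text \<open>For g = E(\<sigma>) f the form at \<sigma> already exhausts <g, g>, the form of the
  whole half-line; additivity leaves 0 for any \<tau> disjoint from \<sigma>.\<close>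

lemma pvm_disjoint:
  assumes f: "f \<in> ell2 V" and \<sigma>: "\<sigma> \<in> sets borel_Rplus" and \<tau>: "\<tau> \<in> sets borel_Rplus"
    and disj: "\<sigma> \<inter> \<tau> = {}"
  shows "the (E \<tau> (the (E \<sigma> f))) = (\<lambda>v. 0)"
proof -
  let ?g = "the (E \<sigma> f)"
  have g: "?g \<in> ell2 V" using proj_ell2[OF pvm_proj[OF \<sigma>] f] .
  have "spectral_form V E ?g \<sigma> + spectral_form V E ?g \<tau> = spectral_form V E ?g (\<sigma> \<union> \<tau>)"
    using spectral_form_Un[OF g \<sigma> \<tau> disj] by simp
  also have "\<dots> \<le> spectral_form V E ?g {0..}"
    using sets.top[of borel_Rplus] sets.sets_into_space[OF sets.Un[OF \<sigma> \<tau>]]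
    by (intro spectral_form_mono[OF g] sets.Un[OF \<sigma> \<tau>]) simp_all
  also have "\<dots> = spectral_form V E ?g \<sigma>"
    by (simp add: spectral_form_full[OF g]) (simp add: spectral_form_def proj_idem[OF pvm_proj[OF \<sigma>] f])
  finally have "spectral_form V E ?g \<tau> = 0"
    using spectral_form_nonneg[OF g \<tau>] by simp
  then show ?thesis by (rule pvm_eq_0D[OF g \<tau>])
qed

text \<open>E(\<sigma>) annihilates the residual f - E(\<sigma>) f, and monotonicity of the forms
  passes this to every subset of \<sigma>.\<close>

lemma pvm_subset_compl:
  assumes f: "f \<in> ell2 V" and \<sigma>: "\<sigma> \<in> sets borel_Rplus" and \<tau>: "\<tau> \<in> sets borel_Rplus"
    and sub: "\<tau> \<subseteq> \<sigma>"
  shows "the (E \<tau> (\<lambda>v. f v - the (E \<sigma> f) v)) = (\<lambda>v. 0)"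
proof -
  let ?k = "\<lambda>v. f v - the (E \<sigma> f) v"
  have k: "?k \<in> ell2 V" using proj_ell2[OF pvm_proj[OF \<sigma>] f] f by (intro ell2_diff)
  have "the (E \<sigma> ?k) = (\<lambda>v. 0)"
    using f proj_ell2[OF pvm_proj[OF \<sigma>] f]
    by (simp add: proj_diff[OF pvm_proj[OF \<sigma>]] proj_idem[OF pvm_proj[OF \<sigma>]])
  then have "spectral_form V E ?k \<sigma> = 0"
    by (simp add: spectral_form_def ell2_inner_def)
  then have "spectral_form V E ?k \<tau> = 0"
    using spectral_form_mono[OF k \<tau> \<sigma> sub] spectral_form_nonneg[OF k \<tau>] by simp
  then show ?thesis by (rule pvm_eq_0D[OF k \<tau>])
qed

text \<open>The spectral measures of the two pieces of f are those of f cut down to \<sigma> and to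
  its complement. This is what allows moments of the pieces to be written as integrals for f
  itself.\<close>

lemma spectral_form_restrict:
  assumes f: "f \<in> ell2 V" and \<sigma>: "\<sigma> \<in> sets borel_Rplus" and \<tau>: "\<tau> \<in> sets borel_Rplus"
  shows "spectral_form V E (the (E \<sigma> f)) \<tau> = spectral_form V E f (\<sigma> \<inter> \<tau>)"
    and "spectral_form V E (\<lambda>v. f v - the (E \<sigma> f) v) \<tau> = spectral_form V E f (({0..} - \<sigma>) \<inter> \<tau>)"
proof -
  let ?g = "the (E \<sigma> f)" and ?k = "\<lambda>v. f v - the (E \<sigma> f) v"
  have g: "?g \<in> ell2 V" using proj_ell2[OF pvm_proj[OF \<sigma>] f] .
  have k: "?k \<in> ell2 V" using g f by (intro ell2_diff)
  have in1: "\<sigma> \<inter> \<tau> \<in> sets borel_Rplus" and in2: "\<tau> - \<sigma> \<in> sets borel_Rplus"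
    by (rule sets.Int[OF \<sigma> \<tau>], rule sets.Diff[OF \<tau> \<sigma>])
  have split: "spectral_form V E h \<tau> = spectral_form V E h (\<sigma> \<inter> \<tau>) + spectral_form V E h (\<tau> - \<sigma>)"
    if "h \<in> ell2 V" for h
  proof -
    have "\<tau> = (\<sigma> \<inter> \<tau>) \<union> (\<tau> - \<sigma>)" by blast
    moreover have "(\<sigma> \<inter> \<tau>) \<inter> (\<tau> - \<sigma>) = {}" by blast
    ultimately show ?thesis using spectral_form_Un[OF that in1 in2] by metis
  qed
  \<comment> \<open>The form at \<rho> depends on h only through E(\<rho>) h. So it suffices that
    E(\<sigma> \<inter> \<tau>) and E(\<tau> - \<sigma>) each kill one piece and send the other to
    the same vector as f.\<close>
  have form_eq: "spectral_form V E h \<rho> = Re (ell2_inner V (the (E \<rho> h)) (the (E \<rho> h)))"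
    if "h \<in> ell2 V" "\<rho> \<in> sets borel_Rplus" for h \<rho>
    using proj_form[OF pvm_proj[OF that(2)] that(1)] by (simp add: spectral_form_def)
  have "the (E (\<tau> - \<sigma>) ?g) = (\<lambda>v. 0)"
    by (rule pvm_disjoint[OF f \<sigma> in2]) blast
  moreover from this have "the (E (\<tau> - \<sigma>) ?k) = the (E (\<tau> - \<sigma>) f)"
    using proj_diff[OF pvm_proj[OF in2] f g] by simp
  moreover have "the (E (\<sigma> \<inter> \<tau>) ?k) = (\<lambda>v. 0)"
    by (rule pvm_subset_compl[OF f \<sigma> in1]) blast
  moreover from this have "the (E (\<sigma> \<inter> \<tau>) ?g) = the (E (\<sigma> \<inter> \<tau>) f)"
    using proj_diff[OF pvm_proj[OF in1] f g] by (simp add: fun_eq_iff)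
  moreover have "({0..} - \<sigma>) \<inter> \<tau> = \<tau> - \<sigma>"
    using sets.sets_into_space[OF \<tau>] by auto
  ultimately show "spectral_form V E ?g \<tau> = spectral_form V E f (\<sigma> \<inter> \<tau>)"
    and "spectral_form V E ?k \<tau> = spectral_form V E f (({0..} - \<sigma>) \<inter> \<tau>)"
    using f g k in1 in2 by (simp_all add: split form_eq) (simp_all add: ell2_inner_def)
qed

end

section \<open>The spectral measure of a diagonal operator\<close>

text \<open>Restricted to Borel sets so that the value elsewhere is \<open>undefined\<close>, as the
  extensional function space in \<open>projection_valued_measure\<close> requires; uniqueness of the
  spectral measure relies on this.\<close>

definition diag_spectral :: "'a set \<Rightarrow> ('a \<Rightarrow> real) \<Rightarrow> real set \<Rightarrow> 'a oper" where
  "diag_spectral V d = (\<lambda>\<sigma>\<in>sets borel_Rplus. diag_oper V (\<lambda>v. indicator \<sigma> (d v)))"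

lemma diag_indicator_ell2:
  assumes "f \<in> ell2 V"
  shows "(\<lambda>v. complex_of_real (indicator \<sigma> (d v)) * f v) \<in> ell2 V"
  by (rule ell2_dominated[OF ell2_summable[OF assms]])
    (use assms in \<open>auto simp: ell2_zero_outside indicator_def\<close>)

lemma dom_diag_indicator: "dom (diag_oper V (\<lambda>v. indicator \<sigma> (d v))) = ell2 V"
  unfolding dom_diag_oper by (auto intro: diag_indicator_ell2)

lemma the_diag_spectral:
  assumes "\<sigma> \<in> sets borel_Rplus" "f \<in> ell2 V"
  shows "the (diag_spectral V d \<sigma> f) = (\<lambda>v. of_real (indicator \<sigma> (d v)) * f v)"
  using assms by (simp add: diag_spectral_def the_diag_oper dom_diag_indicator del: domIff)

lemma spectral_form_diag_spectral:
  assumes "\<sigma> \<in> sets borel_Rplus" "f \<in> ell2 V"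
  shows "spectral_form V (diag_spectral V d) f \<sigma> = (\<Sum>\<^sub>\<infinity>v\<in>V. indicator \<sigma> (d v) * (cmod (f v))\<^sup>2)"
proof -
  have "of_real (indicator \<sigma> (d v)) * f v * cnj (f v) = of_real (indicator \<sigma> (d v) * (cmod (f v))\<^sup>2)" for v
    by (simp add: complex_norm_square[symmetric] mult.assoc del: of_real_power)
  then show ?thesis
    using assms unfolding spectral_form_def ell2_inner_def
    by (simp add: the_diag_spectral infsum_complex_of_real del: of_real_mult)
qed

lemma orth_projection_diag_indicator: "orth_projection V (diag_oper V (\<lambda>v. indicator \<sigma> (d v)))"
proof -
  have "(\<lambda>v. (indicator \<sigma> (d v) :: real)\<^sup>2) = (\<lambda>v. indicator \<sigma> (d v))"
    by (simp add: fun_eq_iff indicator_def)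
  then show ?thesis
    by (simp add: orth_projection_def linear_diag_oper dom_diag_indicator adjoint_diag_oper
        diag_oper_comp_self)
qed

text \<open>The scalar measure <E(.) f, f> in explicit form: the image under d of the weights |f|^2
  on V. Being a measure by construction, it provides countable additivity of the forms.\<close>

definition diag_measure :: "'a set \<Rightarrow> ('a \<Rightarrow> real) \<Rightarrow> ('a \<Rightarrow> complex) \<Rightarrow> real measure" where
  "diag_measure V d f = distr (density (count_space V) (\<lambda>v. ennreal ((cmod (f v))\<^sup>2))) borel_Rplus d"

context
  fixes V :: "'a set" and d :: "'a \<Rightarrow> real"
  assumes d_nonneg: "\<And>v. v \<in> V \<Longrightarrow> 0 \<le> d v"
begin

lemma measurable_eigenvalue: "d \<in> measurable (density (count_space V) w) borel_Rplus"
  using d_nonneg by (auto simp: measurable_def space_restrict_space)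

lemma summable_indicator_mult:
  "f \<in> ell2 V \<Longrightarrow> (\<lambda>v. indicator \<sigma> (d v) * (cmod (f v))\<^sup>2) summable_on V"
  by (rule summable_on_comparison_test[OF ell2_summable[of f V]]) (auto simp: indicator_def)

lemma nn_integral_diag_measure:
  assumes "g \<in> borel_measurable borel"
  shows "(\<integral>\<^sup>+x. g x \<partial>diag_measure V d f) = (\<integral>\<^sup>+v. ennreal ((cmod (f v))\<^sup>2) * g (d v) \<partial>count_space V)"
proof -
  have "g \<in> borel_measurable borel_Rplus" using assms by (rule measurable_restrict_space1)
  then have "(\<integral>\<^sup>+x. g x \<partial>diag_measure V d f)
      = (\<integral>\<^sup>+v. g (d v) \<partial>density (count_space V) (\<lambda>v. ennreal ((cmod (f v))\<^sup>2)))"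
    unfolding diag_measure_def by (intro nn_integral_distr[OF measurable_eigenvalue]) simp
  also have "\<dots> = (\<integral>\<^sup>+v. ennreal ((cmod (f v))\<^sup>2) * g (d v) \<partial>count_space V)"
    by (rule nn_integral_density) auto
  finally show ?thesis .
qed

lemma emeasure_diag_measure:
  assumes \<sigma>: "\<sigma> \<in> sets borel_Rplus" and f: "f \<in> ell2 V"
  shows "emeasure (diag_measure V d f) \<sigma> = ennreal (spectral_form V (diag_spectral V d) f \<sigma>)"
proof -
  have "emeasure (diag_measure V d f) \<sigma> = (\<integral>\<^sup>+x. indicator \<sigma> x \<partial>diag_measure V d f)"
    using \<sigma> by (intro nn_integral_indicator[symmetric]) (simp add: diag_measure_def)
  also have "\<dots> = (\<integral>\<^sup>+v. ennreal ((cmod (f v))\<^sup>2) * indicator \<sigma> (d v) \<partial>count_space V)"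
  proof (rule nn_integral_diag_measure)
    have "\<sigma> \<in> sets borel"
      using \<sigma> sets_restrict_space_iff[of "{0..}" borel \<sigma>] by simp
    then show "indicator \<sigma> \<in> borel_measurable borel" by (rule borel_measurable_indicator)
  qed
  also have "\<dots> = (\<integral>\<^sup>+v. ennreal (indicator \<sigma> (d v) * (cmod (f v))\<^sup>2) \<partial>count_space V)"
    by (intro nn_integral_cong) (simp add: indicator_def)
  also have "\<dots> = ennreal (spectral_form V (diag_spectral V d) f \<sigma>)"
    using assms summable_indicator_mult[OF f]
    by (simp add: spectral_form_diag_spectral nn_integral_count_space_infsum)
  finally show ?thesis .
qed

lemma sets_diag_measure: "sets (diag_measure V d f) = sets borel_Rplus"
  and space_diag_measure: "space (diag_measure V d f) = {0..}"
  by (simp_all add: diag_measure_def)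

lemma spectral_form_measure_diag_spectral:
  assumes f: "f \<in> ell2 V"
  shows "spectral_form_measure V (diag_spectral V d) f = diag_measure V d f"
proof -
  have "sigma_sets {0..} (sets borel_Rplus) = sets borel_Rplus"
    by (rule sigma_algebra.sigma_sets_eq[OF sigma_algebra_borel_Rplus])
  then have "spectral_form_measure V (diag_spectral V d) f
      = measure_of {0..} (sets borel_Rplus) (emeasure (diag_measure V d f))"
    unfolding spectral_form_measure_def
    by (intro measure_of_eq) (use f sets.space_closed[of borel_Rplus] in \<open>auto simp: emeasure_diag_measure\<close>)
  also have "\<dots> = diag_measure V d f"
    using measure_of_of_measure[of "diag_measure V d f"]
    by (simp add: sets_diag_measure space_diag_measure)
  finally show ?thesis .
qed

lemma projection_valued_measure_diag_spectral: "projection_valued_measure V (diag_spectral V d)"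
  unfolding projection_valued_measure_def
proof (intro conjI ballI)
  show "diag_spectral V d \<in> sets borel_Rplus \<rightarrow>\<^sub>E {P. orth_projection V P}"
    by (auto simp: diag_spectral_def orth_projection_diag_indicator)
  have "{0..} \<in> sets borel_Rplus"
    using sets.top[of borel_Rplus] by simp
  then have "diag_spectral V d {0..} = diag_oper V (\<lambda>v. indicator {0..} (d v))"
    by (simp add: diag_spectral_def)
  also have "\<dots> = Some |` ell2 V"
  proof
    fix f
    show "diag_oper V (\<lambda>v. indicator {0..} (d v)) f = (Some |` ell2 V) f"
    proof (cases "f \<in> ell2 V")
      case True
      then have "(\<lambda>v. complex_of_real (indicator {0..} (d v)) * f v) = f"
        using d_nonneg ell2_zero_outside[OF True] by (auto simp: fun_eq_iff indicator_def)
      then show ?thesis using True by (simp add: diag_oper_def restrict_map_def)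
    qed (simp add: diag_oper_def restrict_map_def)
  qed
  finally show "diag_spectral V d {0..} = Some |` ell2 V" .
next
  fix h assume h: "h \<in> ell2 V"
  have "countably_additive (sets borel_Rplus) (emeasure (diag_measure V d h))"
    using emeasure_countably_additive[of "diag_measure V d h"] by (simp add: sets_diag_measure)
  then show "countably_additive (sets borel_Rplus) (\<lambda>\<sigma>. ennreal (spectral_form V (diag_spectral V d) h \<sigma>))"
    unfolding countably_additive_def
    using emeasure_diag_measure[OF _ h] by (auto simp: image_subset_iff)
qed

text \<open>The second moment is the sum of d^2 |f|^2, so its finiteness is the domain condition.
  The first moment is the sum of d |f|^2, summable because both d f and f are in
  \<open>ell2 V\<close>.\<close>

lemma is_spectral_measure_diag_spectral: "is_spectral_measure_of V (diag_spectral V d) (diag_oper V d)"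
  unfolding is_spectral_measure_of_def
proof (intro conjI ballI)
  show "projection_valued_measure V (diag_spectral V d)"
    by (rule projection_valued_measure_diag_spectral)
  have dom: "(\<integral>\<^sup>+x. ennreal (x\<^sup>2) \<partial>spectral_form_measure V (diag_spectral V d) f) < \<infinity> \<longleftrightarrow>
    (\<lambda>v. of_real (d v) * f v) \<in> ell2 V" if f: "f \<in> ell2 V" for f :: "'a \<Rightarrow> complex"
  proof -
    have "(\<integral>\<^sup>+x. ennreal (x\<^sup>2) \<partial>diag_measure V d f)
        = (\<integral>\<^sup>+v. ennreal ((cmod (f v))\<^sup>2) * ennreal ((d v)\<^sup>2) \<partial>count_space V)"
      by (rule nn_integral_diag_measure) measurable
    also have "\<dots> = (\<integral>\<^sup>+v. ennreal ((cmod (of_real (d v) * f v))\<^sup>2) \<partial>count_space V)"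
      by (intro nn_integral_cong) (simp add: norm_mult power_mult_distrib ennreal_mult mult.commute)
    finally show ?thesis
      using nn_integral_count_space_finite_iff_summable[of V "\<lambda>v. (cmod (of_real (d v) * f v))\<^sup>2"] f
      by (simp add: spectral_form_measure_diag_spectral ell2_def)
  qed
  then show "dom (diag_oper V d)
      = {f \<in> ell2 V. (\<integral>\<^sup>+x. ennreal (x\<^sup>2) \<partial>spectral_form_measure V (diag_spectral V d) f) < \<infinity>}"
    unfolding dom_diag_oper by blast
next
  fix f assume fdom: "f \<in> dom (diag_oper V d)"
  then have f: "f \<in> ell2 V" and df: "(\<lambda>v. of_real (d v) * f v) \<in> ell2 V"
    by (simp_all add: dom_diag_oper del: domIff)
  have eq: "of_real (d v) * f v * cnj (f v) = of_real (d v * (cmod (f v))\<^sup>2)" for v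
    by (simp add: complex_norm_square[symmetric] mult.assoc del: of_real_power)
  have summ: "(\<lambda>v. d v * (cmod (f v))\<^sup>2) summable_on V"
    using summable_on_Re[OF ell2_inner_summable[OF df f]] unfolding eq by simp
  have "(\<integral>x. x \<partial>diag_measure V d f) = enn2real (\<integral>\<^sup>+x. ennreal x \<partial>diag_measure V d f)"
  proof (rule integral_eq_nn_integral)
    show "(\<lambda>x. x) \<in> borel_measurable (diag_measure V d f)"
      using measurable_spectral_form_measure[of "\<lambda>x. x" V "diag_spectral V d" f] f
      by (simp add: spectral_form_measure_diag_spectral)
  qed (rule AE_I2, simp add: space_diag_measure)
  also have "(\<integral>\<^sup>+x. ennreal x \<partial>diag_measure V d f)
      = (\<integral>\<^sup>+v. ennreal ((cmod (f v))\<^sup>2) * ennreal (d v) \<partial>count_space V)"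
    by (rule nn_integral_diag_measure) measurable
  also have "\<dots> = (\<integral>\<^sup>+v. ennreal (d v * (cmod (f v))\<^sup>2) \<partial>count_space V)"
    using d_nonneg by (intro nn_integral_cong) (simp add: ennreal_mult mult.commute)
  also have "\<dots> = ennreal (\<Sum>\<^sub>\<infinity>v\<in>V. d v * (cmod (f v))\<^sup>2)"
    using d_nonneg summ by (intro nn_integral_count_space_infsum) simp_all
  finally have "(\<integral>x. x \<partial>diag_measure V d f) = (\<Sum>\<^sub>\<infinity>v\<in>V. d v * (cmod (f v))\<^sup>2)"
    using d_nonneg by (simp add: infsum_nonneg)
  then show "ell2_inner V (the (diag_oper V d f)) f
      = of_real (\<integral>x. x \<partial>spectral_form_measure V (diag_spectral V d) f)"
    unfolding the_diag_oper[OF fdom] spectral_form_measure_diag_spectral[OF f] ell2_inner_def eq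
    by (simp add: infsum_complex_of_real del: of_real_mult)
qed

end

text \<open>For an eigenvector \<open>e\<close> with eigenvalue \<open>d u\<close> and \<open>g = E(\<sigma>) e\<close>, comparing the quadratic forms at
  \<open>e\<close>, \<open>g\<close> and \<open>e - g\<close> gives \<open>\<langle>T g, g\<rangle> = d u * \<langle>g, g\<rangle>\<close>, that is, the measure \<open>\<langle>E(\<cdot>) e, e\<rangle>\<close> gives the
  functions \<open>x\<close> and \<open>d u\<close> equal integrals over every \<open>\<sigma>\<close>.\<close>

lemma spectral_measure_basis_concentrated:
  assumes sp: "is_spectral_measure_of V E (diag_oper V d)" and u: "u \<in> V"
  shows "AE x in spectral_form_measure V E (basis_vec u). x = d u"
proof -
  let ?e = "basis_vec u" and ?D = "diag_oper V d"
  let ?M = "spectral_form_measure V E (basis_vec u)"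
  have pvm: "projection_valued_measure V E"
    and dom: "dom ?D = {f \<in> ell2 V. (\<integral>\<^sup>+x. ennreal (x\<^sup>2) \<partial>spectral_form_measure V E f) < \<infinity>}"
    and form: "\<And>f. f \<in> dom ?D \<Longrightarrow>
      ell2_inner V (the (?D f)) f = of_real (\<integral>x. x \<partial>spectral_form_measure V E f)"
    using sp unfolding is_spectral_measure_of_def by blast+
  have e: "?e \<in> ell2 V" using u by (rule basis_vec_ell2)
  interpret M: finite_measure ?M by (rule finite_spectral_form_measure[OF pvm e])
  have meas: "(\<lambda>x. x) \<in> borel_measurable ?M" "(\<lambda>x. ennreal (x\<^sup>2)) \<in> borel_measurable ?M"
    by (rule measurable_spectral_form_measure, measurable)+
  have e2: "(\<integral>\<^sup>+x. ennreal (x\<^sup>2) \<partial>?M) < \<infinity>"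
    using basis_vec_dom_diag[OF u, of d] unfolding dom by blast
  have int: "integrable ?M (\<lambda>x. x)"
  proof (rule M.square_integrable_imp_integrable[OF meas(1)])
    show "integrable ?M (\<lambda>x. x\<^sup>2)"
      using meas(1) e2 by (intro integrableI_nonneg) simp_all
  qed
  \<comment> \<open>If the measure of h is that of e restricted to \<rho>, its second moment is no
    larger, which puts h in the domain. This serves for E(\<sigma>) e with \<rho> = \<sigma> and for
    e - E(\<sigma>) e with the complement.\<close>
  have piece: "h \<in> dom ?D \<and> Re (ell2_inner V (the (?D h)) h) = (\<integral>x. indicator \<rho> x * x \<partial>?M)"
    if h: "h \<in> ell2 V" and \<rho>: "\<rho> \<in> sets borel_Rplus"
      and h\<rho>: "\<And>\<tau>. \<tau> \<in> sets borel_Rplus \<Longrightarrow> spectral_form V E h \<tau> = spectral_form V E ?e (\<rho> \<inter> \<tau>)"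
    for h \<rho>
  proof -
    have dens: "spectral_form_measure V E h = density ?M (\<lambda>x. ennreal (indicator \<rho> x))"
    proof (rule measure_eqI)
      fix \<tau> assume "\<tau> \<in> sets (spectral_form_measure V E h)"
      then have \<tau>: "\<tau> \<in> sets borel_Rplus" by simp
      then show "emeasure (spectral_form_measure V E h) \<tau>
          = emeasure (density ?M (\<lambda>x. ennreal (indicator \<rho> x))) \<tau>"
        using h\<rho>[OF \<tau>] emeasure_restricted[of \<rho> ?M \<tau>] \<rho> sets.Int[OF \<rho> \<tau>] h e
        by (simp add: emeasure_spectral_form_measure[OF pvm] ennreal_indicator)
    qed simp
    have [measurable]: "(\<lambda>x. indicator \<rho> x :: real) \<in> borel_measurable ?M"
      using \<rho> by (intro borel_measurable_indicator) simp
    have "(\<integral>\<^sup>+x. ennreal (x\<^sup>2) \<partial>spectral_form_measure V E h)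
        = (\<integral>\<^sup>+x. ennreal (indicator \<rho> x) * ennreal (x\<^sup>2) \<partial>?M)"
      unfolding dens using meas by (intro nn_integral_density) measurable
    also have "\<dots> \<le> (\<integral>\<^sup>+x. ennreal (x\<^sup>2) \<partial>?M)"
      by (intro nn_integral_mono) (auto simp: indicator_def)
    also note e2
    finally have hdom: "h \<in> dom ?D" unfolding dom using h by blast
    have "(\<integral>x. x \<partial>spectral_form_measure V E h) = (\<integral>x. indicator \<rho> x * x \<partial>?M)"
      unfolding dens using meas(1) by (subst integral_density) auto
    then show ?thesis
      using hdom form[OF hdom] by simp
  qed
  show ?thesis
  \<comment> \<open>Reduces almost everywhere equality of x and d u to equality of their integrals
    over each \<sigma>.\<close>
  proof (rule density_unique_real[OF int])
    fix \<sigma> assume "\<sigma> \<in> sets ?M"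
    then have \<sigma>: "\<sigma> \<in> sets borel_Rplus" by simp
    have "\<sigma> \<inter> {0..} = \<sigma>" using sets.sets_into_space[OF \<sigma>] by auto
    let ?g = "the (E \<sigma> ?e)"
    let ?k = "\<lambda>v. ?e v - ?g v"
    have g: "?g \<in> ell2 V" by (rule proj_ell2[OF pvm_proj[OF pvm \<sigma>] e])
    have k: "?k \<in> ell2 V" using e g by (rule ell2_diff)
    have c\<sigma>: "{0..} - \<sigma> \<in> sets borel_Rplus"
      using sets.compl_sets[OF \<sigma>] by simp
    let ?G = "Re (ell2_inner V (the (?D ?g)) ?g)" and ?K = "Re (ell2_inner V (the (?D ?k)) ?k)"
    have gd: "?g \<in> dom ?D" and G: "?G = (\<integral>x. indicator \<sigma> x * x \<partial>?M)"
      using piece[OF g \<sigma>] spectral_form_restrict(1)[OF pvm e \<sigma>] by blast+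
    have kd: "?k \<in> dom ?D" and K: "?K = (\<integral>x. indicator ({0..} - \<sigma>) x * x \<partial>?M)"
      using piece[OF k c\<sigma>] spectral_form_restrict(2)[OF pvm e \<sigma>] by blast+
    have i1: "integrable ?M (\<lambda>x. indicator \<rho> x * x)" if "\<rho> \<in> sets borel_Rplus" for \<rho>
      using integrable_mult_indicator[of \<rho> ?M "\<lambda>x. x"] int that by simp
    have ed: "?e \<in> dom ?D" by (rule basis_vec_dom_diag[OF u])
    have De: "the (?D ?e) = (\<lambda>v. of_real (d u) * ?e v)"
      using the_diag_oper[OF ed] by (auto simp: basis_vec_apply)
    have "ell2_inner V (the (?D ?e)) ?e = of_real (d u)"
      unfolding De using u by (simp add: ell2_inner_basis_right basis_vec_apply)
    then have "d u = (\<integral>x. x \<partial>?M)"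
      using form[OF ed] by (metis of_real_eq_iff)
    also have "\<dots> = (\<integral>x. indicator \<sigma> x * x + indicator ({0..} - \<sigma>) x * x \<partial>?M)"
      using sets.sets_into_space[OF \<sigma>] by (intro Bochner_Integration.integral_cong) (auto simp: indicator_def)
    also have "\<dots> = ?G + ?K"
      unfolding G K using i1[OF \<sigma>] i1[OF c\<sigma>] by (rule Bochner_Integration.integral_add)
    finally have sum: "d u = ?G + ?K" .
    \<comment> \<open>Both cross terms pair with e and are known because e is an eigenvector. In
      real parts this reads K = G + d u - 2 (d u) Re (g u); combined with G + K = d u it yields G =
      (d u) Re (g u).\<close>
    have "ell2_inner V (the (?D ?k)) ?k
        = ell2_inner V (the (?D ?g)) ?g + of_real (d u) - of_real (d u) * ?g u - of_real (d u) * cnj (?g u)"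
    proof -
      have Dg2: "the (?D ?g) \<in> ell2 V" and De2: "the (?D ?e) \<in> ell2 V"
        using gd ed by (simp_all add: the_diag_oper dom_diag_oper del: domIff)
      have "the (?D ?k) = (\<lambda>v. the (?D ?e) v - the (?D ?g) v)"
        by (simp add: the_diag_oper[OF kd] the_diag_oper[OF ed] the_diag_oper[OF gd] algebra_simps)
      then have "ell2_inner V (the (?D ?k)) ?k
          = ell2_inner V (the (?D ?e)) ?e - ell2_inner V (the (?D ?e)) ?g
            - (ell2_inner V (the (?D ?g)) ?e - ell2_inner V (the (?D ?g)) ?g)"
        using Dg2 De2 e g k by (simp add: ell2_inner_diff_left ell2_inner_diff_right)
      moreover have "ell2_inner V (the (?D ?e)) ?g = of_real (d u) * cnj (?g u)"
        unfolding De using ell2_inner_lincomb_left[OF e e g, of "of_real (d u)" 0] u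
        by (simp add: ell2_inner_basis_left)
      moreover have "ell2_inner V (the (?D ?g)) ?e = of_real (d u) * ?g u"
        using u by (simp add: ell2_inner_basis_right the_diag_oper[OF gd])
      ultimately show ?thesis
        using \<open>ell2_inner V (the (?D ?e)) ?e = of_real (d u)\<close> by simp
    qed
    then have "?K = ?G + d u - 2 * d u * Re (?g u)"
      by simp
    moreover have "Re (?g u) = measure ?M \<sigma>"
    proof -
      have "Re (?g u) = spectral_form V E ?e \<sigma>"
        using u by (simp add: spectral_form_def ell2_inner_basis_right)
      then show ?thesis
        using emeasure_spectral_form_measure[OF pvm e \<sigma>] spectral_form_nonneg[OF pvm e \<sigma>]
        by (simp add: measure_def)
    qed
    ultimately have "?G = d u * measure ?M \<sigma>"
      using sum by (simp add: algebra_simps)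
    moreover have "(\<integral>x. indicator \<sigma> x * d u \<partial>?M) = d u * measure ?M \<sigma>"
      using \<open>\<sigma> \<inter> {0..} = \<sigma>\<close> by simp
    ultimately have "(\<integral>x. indicator \<sigma> x * x \<partial>?M) = (\<integral>x. indicator \<sigma> x * d u \<partial>?M)"
      using G by (simp only:)
    then show "(LINT x:\<sigma>|?M. x) = (LINT x:\<sigma>|?M. d u)"
      by (simp only: set_lebesgue_integral_def real_scaleR_def)
  qed simp
qed

text \<open>Concentration at d u forces E(\<sigma>) e_u to be e_u or 0, according to whether d u
  lies in \<sigma>. Symmetry of the projections then fixes all coordinates of E(\<sigma>) f.\<close>

lemma spectral_measure_diag_unique:
  assumes sp: "is_spectral_measure_of V E (diag_oper V d)"
  shows "E = diag_spectral V d"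
proof -
  have pvm: "projection_valued_measure V E"
    using sp by (simp add: is_spectral_measure_of_def)
  have basis: "the (E \<sigma> (basis_vec u)) = (\<lambda>v. of_real (indicator \<sigma> (d u)) * basis_vec u v)"
    if \<sigma>: "\<sigma> \<in> sets borel_Rplus" and u: "u \<in> V" for \<sigma> u
  proof -
    let ?e = "basis_vec u"
    let ?M = "spectral_form_measure V E ?e"
    have e: "?e \<in> ell2 V" using u by (rule basis_vec_ell2)
    note conc = spectral_measure_basis_concentrated[OF sp u]
    have null: "spectral_form V E ?e \<rho> = 0" if \<rho>: "\<rho> \<in> sets borel_Rplus" and nin: "d u \<notin> \<rho>" for \<rho>
    proof -
      have "AE x in ?M. \<not> x \<in> \<rho>" using conc by eventually_elim (use nin in auto)
      then have "emeasure ?M {x \<in> space ?M. x \<in> \<rho>} = 0" by (rule emeasure_eq_0_AE)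
      moreover have "{x \<in> space ?M. x \<in> \<rho>} = \<rho>" using sets.sets_into_space[OF \<rho>] by auto
      ultimately show ?thesis
        using emeasure_spectral_form_measure[OF pvm e \<rho>] spectral_form_nonneg[OF pvm e \<rho>] by simp
    qed
    show ?thesis
    proof (cases "d u \<in> \<sigma>")
      case False
      then show ?thesis using pvm_eq_0D[OF pvm e \<sigma> null[OF \<sigma>]] by simp
    next
      case True
      have c\<sigma>: "{0..} - \<sigma> \<in> sets borel_Rplus" using sets.compl_sets[OF \<sigma>] by simp
      have "\<sigma> \<union> ({0..} - \<sigma>) = {0..}" using sets.sets_into_space[OF \<sigma>] by auto
      \<comment> \<open>The complement of \<sigma> misses d u and is null, so <E(\<sigma>) e, e> =
        <e, e> and the projection fixes e.\<close>
      then have "spectral_form V E ?e {0..} = spectral_form V E ?e \<sigma>"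
        using spectral_form_Un[OF pvm e \<sigma> c\<sigma>] null[OF c\<sigma>] True by simp
      then have "the (E \<sigma> ?e) = ?e"
        using spectral_form_full[OF pvm e]
        by (intro proj_eq_selfI[OF pvm_proj[OF pvm \<sigma>] e]) (simp add: spectral_form_def)
      then show ?thesis using True by simp
    qed
  qed
  have "E \<sigma> f = diag_spectral V d \<sigma> f" if \<sigma>: "\<sigma> \<in> sets borel_Rplus" for \<sigma> f
  proof (cases "f \<in> ell2 V")
    case True
    have "the (E \<sigma> f) = (\<lambda>v. of_real (indicator \<sigma> (d v)) * f v)"
    proof (rule ell2_eqI)
      fix u assume u: "u \<in> V"
      have "the (E \<sigma> f) u = ell2_inner V f (the (E \<sigma> (basis_vec u)))"
        using proj_sym[OF pvm_proj[OF pvm \<sigma>] True basis_vec_ell2[OF u]] u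
        by (simp add: ell2_inner_basis_right)
      also have "\<dots> = of_real (indicator \<sigma> (d u)) * f u"
        unfolding basis[OF \<sigma> u] ell2_inner_def using u
        by (simp add: basis_vec_apply infsum_single[of u])
      finally show "the (E \<sigma> f) u = of_real (indicator \<sigma> (d u)) * f u" .
    qed (rule proj_ell2[OF pvm_proj[OF pvm \<sigma>] True], rule diag_indicator_ell2[OF True])
    then have eq: "the (E \<sigma> f) = the (diag_spectral V d \<sigma> f)"
      using the_diag_spectral[OF \<sigma> True] by simp
    have "f \<in> dom (E \<sigma>)"
      using True by (simp only: proj_dom[OF pvm_proj[OF pvm \<sigma>]])
    moreover have "f \<in> dom (diag_spectral V d \<sigma>)"
      using True \<sigma> by (simp add: diag_spectral_def dom_diag_indicator del: domIff)
    ultimately show ?thesis using eq by (auto simp: dom_def)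
  next
    case False
    have "f \<notin> dom (E \<sigma>)"
      using False by (simp only: proj_dom[OF pvm_proj[OF pvm \<sigma>]] not_False_eq_True)
    moreover have "f \<notin> dom (diag_spectral V d \<sigma>)"
      using False \<sigma> by (simp add: diag_spectral_def dom_diag_indicator del: domIff)
    ultimately show ?thesis by (auto simp: dom_def)
  qed
  then have "E \<sigma> = diag_spectral V d \<sigma>" if "\<sigma> \<in> sets borel_Rplus" for \<sigma>
    using that by (intro ext)
  moreover have "E \<sigma> = undefined" if "\<sigma> \<notin> sets borel_Rplus" for \<sigma>
  proof -
    have "E \<in> sets borel_Rplus \<rightarrow>\<^sub>E {P. orth_projection V P}"
      using pvm unfolding projection_valued_measure_def by (rule conjunct1)
    then show ?thesis using that by (rule PiE_arb)
  qed
  ultimately show ?thesis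
    by (intro ext) (metis diag_spectral_def restrict_apply)
qed

lemma spectral_measure_diag:
  assumes "\<And>v. v \<in> V \<Longrightarrow> 0 \<le> d v"
  shows "spectral_measure V (diag_oper V d) = diag_spectral V d"
  unfolding spectral_measure_def
  using is_spectral_measure_diag_spectral[OF assms] spectral_measure_diag_unique by (rule the_equality)

section \<open>Weighted shifts\<close>

text \<open>The eigenvalue of the modulus at e_u. Off V the operator value is unspecified, yet its
  \<open>ell2_norm\<close> is still nonnegative, so nonnegativity holds for every u.\<close>

definition shift_norm :: "'a set \<Rightarrow> ('a \<times> 'a) set \<Rightarrow> ('a \<Rightarrow> complex) \<Rightarrow> 'a \<Rightarrow> real" where
  "shift_norm V Ed lam u = ell2_norm V (the (weighted_shift V Ed lam (basis_vec u)))"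

lemma shift_norm_nonneg: "0 \<le> shift_norm V Ed lam u"
  by (simp add: shift_norm_def ell2_norm_nonneg)

section \<open>Parents, children and sums over the tree\<close>

context
  fixes V :: "'a set" and Ed :: "('a \<times> 'a) set" and lam :: "'a \<Rightarrow> complex"
  assumes T: "directed_tree V Ed"
begin

lemma edge_verts: "(u, v) \<in> Ed \<Longrightarrow> u \<in> V \<and> v \<in> V"
  using T unfolding directed_tree_def by blast

lemma par_eq: "(u, v) \<in> Ed \<Longrightarrow> par Ed v = u"
  unfolding par_def
proof (rule the_equality)
  fix w assume "(u, v) \<in> Ed" "(w, v) \<in> Ed"
  moreover from this have "v \<in> V" using edge_verts by blast
  ultimately show "w = u" using T unfolding directed_tree_def by blast
qed

lemma nonroots_iff: "v \<in> nonroots V Ed \<longleftrightarrow> (\<exists>u. (u, v) \<in> Ed)"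
  unfolding nonroots_def roots_def using edge_verts by blast

lemma mem_Chi_iff: "v \<in> Chi V Ed u \<longleftrightarrow> v \<in> nonroots V Ed \<and> par Ed v = u"
  unfolding nonroots_iff Chi_def using edge_verts par_eq by blast

lemma Chi_subset: "Chi V Ed u \<subseteq> V"
  by (auto simp: Chi_def)

lemma par_mem: "v \<in> nonroots V Ed \<Longrightarrow> par Ed v \<in> V"
  unfolding nonroots_iff using edge_verts par_eq by blast

lemma shift_fun_Chi: "v \<in> Chi V Ed u \<Longrightarrow> shift_fun V Ed lam f v = lam v * f u"
  by (simp add: shift_fun_def mem_Chi_iff)

lemma shift_fun_off: "v \<notin> nonroots V Ed \<Longrightarrow> shift_fun V Ed lam f v = 0"
  by (simp add: shift_fun_def)

lemma shift_fun_outside: "v \<notin> V \<Longrightarrow> shift_fun V Ed lam f v = 0"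
  by (rule shift_fun_off) (simp add: nonroots_def)

text \<open>A pair (parent, child) is determined by the child, and (par v, v) is such a pair for
  each non-root v.\<close>

lemma bij_betw_Chi: "bij_betw snd (Sigma V (Chi V Ed)) (nonroots V Ed)"
  unfolding bij_betw_def
proof
  show "inj_on snd (Sigma V (Chi V Ed))"
    by (rule inj_onI) (auto simp: mem_Chi_iff)
  show "snd ` Sigma V (Chi V Ed) = nonroots V Ed"
  proof (intro equalityI subsetI)
    fix v assume "v \<in> nonroots V Ed"
    then have "(par Ed v, v) \<in> Sigma V (Chi V Ed)" by (simp add: mem_Chi_iff par_mem)
    then show "v \<in> snd ` Sigma V (Chi V Ed)" by force
  qed (auto simp: mem_Chi_iff)
qed

text \<open>Every non-root is a child of exactly one vertex, so sums over \<open>V\<close> of functions vanishing at the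
  root can be grouped by parents.\<close>

lemma summable_on_Chi:
  fixes g :: "'a \<Rightarrow> 'b :: {topological_comm_monoid_add, t2_space}"
  assumes "\<And>v. v \<notin> nonroots V Ed \<Longrightarrow> g v = 0"
  shows "g summable_on V \<longleftrightarrow> (\<lambda>(u, v). g v) summable_on Sigma V (Chi V Ed)"
proof -
  have "g summable_on V \<longleftrightarrow> g summable_on nonroots V Ed"
    by (rule summable_on_cong_neutral) (auto simp: assms nonroots_def)
  also have "\<dots> \<longleftrightarrow> (\<lambda>p. g (snd p)) summable_on Sigma V (Chi V Ed)"
    by (rule summable_on_reindex_bij_betw[OF bij_betw_Chi, symmetric])
  finally show ?thesis by (simp add: case_prod_unfold)
qed

lemma infsum_Chi:
  fixes g :: "'a \<Rightarrow> 'b :: banach"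
  assumes "\<And>v. v \<notin> nonroots V Ed \<Longrightarrow> g v = 0" "g summable_on V"
  shows "infsum g V = (\<Sum>\<^sub>\<infinity>u\<in>V. \<Sum>\<^sub>\<infinity>v\<in>Chi V Ed u. g v)"
proof -
  have "infsum g V = infsum g (nonroots V Ed)"
    by (rule infsum_cong_neutral) (auto simp: assms nonroots_def)
  also have "\<dots> = (\<Sum>\<^sub>\<infinity>p\<in>Sigma V (Chi V Ed). g (snd p))"
    by (rule infsum_reindex_bij_betw[OF bij_betw_Chi, symmetric])
  also have "\<dots> = (\<Sum>\<^sub>\<infinity>u\<in>V. \<Sum>\<^sub>\<infinity>v\<in>Chi V Ed u. g v)"
    using assms summable_on_Chi[of g]
      infsum_Sigma_banach[of "\<lambda>p. g (snd p)" V "Chi V Ed"] by (simp add: case_prod_unfold)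
  finally show ?thesis .
qed

text \<open>Nonnegativity lets summability of the iterated sum imply joint summability. Summability
  on each set of children is required since a divergent inner \<open>infsum\<close> would count as
  0.\<close>

lemma nonneg_summable_on_Chi_iff:
  fixes g :: "'a \<Rightarrow> real"
  assumes "\<And>v. v \<notin> nonroots V Ed \<Longrightarrow> g v = 0" "\<And>v. 0 \<le> g v"
    and "\<And>u. u \<in> V \<Longrightarrow> g summable_on Chi V Ed u"
  shows "g summable_on V \<longleftrightarrow> (\<lambda>u. \<Sum>\<^sub>\<infinity>v\<in>Chi V Ed u. g v) summable_on V"
proof
  assume "g summable_on V"
  then have "(\<lambda>(u, v). g v) summable_on Sigma V (Chi V Ed)"
    using assms(1) summable_on_Chi by blast
  from summable_on_SigmaD[OF this] assms(3)
  show "(\<lambda>u. \<Sum>\<^sub>\<infinity>v\<in>Chi V Ed u. g v) summable_on V" by simp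
next
  assume "(\<lambda>u. \<Sum>\<^sub>\<infinity>v\<in>Chi V Ed u. g v) summable_on V"
  then have "(\<lambda>(u, v). g v) summable_on Sigma V (Chi V Ed)"
    by (rule summable_on_SigmaI[rotated]) (auto simp: assms has_sum_infsum)
  then show "g summable_on V"
    using assms(1) summable_on_Chi by blast
qed

section \<open>The weighted shift as a closed linear operator\<close>

lemma dom_weighted_shift:
  "dom (weighted_shift V Ed lam) = {f \<in> ell2 V. shift_fun V Ed lam f \<in> ell2 V}"
  by (auto simp: weighted_shift_def restrict_map_def split: if_splits)

lemma the_weighted_shift:
  "f \<in> dom (weighted_shift V Ed lam) \<Longrightarrow> the (weighted_shift V Ed lam f) = shift_fun V Ed lam f"
  unfolding dom_weighted_shift by (simp add: weighted_shift_def)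

lemma weighted_shift_eq_Some_iff:
  "weighted_shift V Ed lam f = Some h \<longleftrightarrow>
    f \<in> ell2 V \<and> h \<in> ell2 V \<and> h = shift_fun V Ed lam f"
  by (auto simp: weighted_shift_def restrict_map_def)

lemma shift_fun_lincomb:
  "shift_fun V Ed lam (\<lambda>v. a * f v + b * g v)
    = (\<lambda>v. a * shift_fun V Ed lam f v + b * shift_fun V Ed lam g v)"
  by (auto simp: shift_fun_def algebra_simps)

lemma linear_weighted_shift: "linear_oper V (weighted_shift V Ed lam)"
proof -
  let ?S = "weighted_shift V Ed lam"
  have "(\<lambda>v. 0) \<in> dom ?S"
    unfolding dom_weighted_shift by (simp add: shift_fun_def cong: if_cong)
  then have "dom ?S \<noteq> {}" by blast
  moreover have "dom ?S \<subseteq> ell2 V" "ran ?S \<subseteq> ell2 V"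
    by (auto simp: ran_def weighted_shift_eq_Some_iff)
  moreover have "?S (\<lambda>v. a * f v + b * g v) = Some (\<lambda>v. a * the (?S f) v + b * the (?S g) v)"
    if f: "f \<in> dom ?S" and g: "g \<in> dom ?S" for f g a b
  proof -
    have "f \<in> ell2 V" "g \<in> ell2 V" "shift_fun V Ed lam f \<in> ell2 V" "shift_fun V Ed lam g \<in> ell2 V"
      using f g by (simp_all add: dom_weighted_shift del: domIff)
    then show ?thesis
      unfolding the_weighted_shift[OF f] the_weighted_shift[OF g]
      by (simp add: weighted_shift_eq_Some_iff shift_fun_lincomb ell2_lincomb)
  qed
  ultimately show ?thesis
    unfolding linear_oper_def by blast
qed

text \<open>Norm limits are pointwise limits, and each coordinate of the image involves a single
  coordinate of the argument, so the limit passes through the defining formula.\<close>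

lemma closed_weighted_shift: "closed_oper V (weighted_shift V Ed lam)"
  unfolding closed_oper_def
proof (intro allI ballI impI)
  let ?S = "weighted_shift V Ed lam"
  fix F f h
  assume f: "f \<in> ell2 V" and h: "h \<in> ell2 V" and F: "\<forall>n::nat. F n \<in> dom ?S"
    and Ff: "(\<lambda>n. ell2_norm V (\<lambda>v. F n v - f v)) \<longlonglongrightarrow> 0"
    and Fh: "(\<lambda>n. ell2_norm V (\<lambda>v. the (?S (F n)) v - h v)) \<longlonglongrightarrow> 0"
  have F2: "F n \<in> ell2 V" "shift_fun V Ed lam (F n) \<in> ell2 V" for n
    using F by (simp_all add: dom_weighted_shift del: domIff)
  have the: "the (?S (F n)) = shift_fun V Ed lam (F n)" for n
    using F by (intro the_weighted_shift) blast
  have "h v = shift_fun V Ed lam f v" for v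
  proof (rule LIMSEQ_unique)
    show "(\<lambda>n. shift_fun V Ed lam (F n) v) \<longlonglongrightarrow> h v"
      using Fh unfolding the by (rule ell2_norm_tendsto_pointwise) (auto intro: F2 h)
    show "(\<lambda>n. shift_fun V Ed lam (F n) v) \<longlonglongrightarrow> shift_fun V Ed lam f v"
      unfolding shift_fun_def
      using ell2_norm_tendsto_pointwise[OF Ff F2(1) f, of "par Ed v"]
      by (auto intro: tendsto_mult_left)
  qed
  then have "h = shift_fun V Ed lam f" ..
  then show "?S f = Some h" using f h by (simp add: weighted_shift_eq_Some_iff)
qed

section \<open>Modulus and spectral measure of a densely defined shift\<close>

context
  assumes dense: "densely_defined V (weighted_shift V Ed lam)"
begin

text \<open>A domain vector g at distance less than 1 from e_u has g u nonzero. On the children of u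
  its image is \<open>lam\<close> times g u, so division by g u gives the claim.\<close>

lemma weights_summable:
  assumes u: "u \<in> V"
  shows "(\<lambda>v. (cmod (lam v))\<^sup>2) summable_on Chi V Ed u"
proof -
  obtain g where g: "g \<in> dom (weighted_shift V Ed lam)"
    and less: "ell2_norm V (\<lambda>v. basis_vec u v - g v) < 1"
    using dense basis_vec_ell2[OF u] unfolding densely_defined_def by (meson zero_less_one)
  have g2: "g \<in> ell2 V" and Sg: "shift_fun V Ed lam g \<in> ell2 V"
    using g by (simp_all add: dom_weighted_shift del: domIff)
  have "cmod (basis_vec u u - g u) < 1"
    using cmod_le_ell2_norm[OF ell2_diff[OF basis_vec_ell2[OF u] g2] u] less by linarith
  then have gu: "g u \<noteq> 0" by (auto simp: basis_vec_apply)
  have "(\<lambda>v. (cmod (shift_fun V Ed lam g v))\<^sup>2) summable_on Chi V Ed u"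
    by (rule summable_on_subset_banach[OF ell2_summable[OF Sg] Chi_subset])
  then have "(\<lambda>v. (cmod (lam v))\<^sup>2 * (cmod (g u))\<^sup>2) summable_on Chi V Ed u"
    by (simp add: shift_fun_Chi norm_mult power_mult_distrib cong: summable_on_cong)
  then show ?thesis
    using gu by (simp add: summable_on_cmult_left')
qed

text \<open>The image of e_u is \<open>lam\<close> on the children of u and 0 elsewhere, so both
  claims are read off from the sum over these children.\<close>

lemma basis_vec_shift:
  assumes u: "u \<in> V"
  shows basis_vec_dom_shift: "basis_vec u \<in> dom (weighted_shift V Ed lam)"
    and shift_norm_power2: "(shift_norm V Ed lam u)\<^sup>2 = (\<Sum>\<^sub>\<infinity>v\<in>Chi V Ed u. (cmod (lam v))\<^sup>2)"
proof -
  let ?g = "shift_fun V Ed lam (basis_vec u)"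
  have off: "?g v = 0" if "v \<notin> Chi V Ed u" for v
    using that by (auto simp: shift_fun_def mem_Chi_iff basis_vec_apply)
  have on: "?g v = lam v" if "v \<in> Chi V Ed u" for v
    using shift_fun_Chi[OF that] by (simp add: basis_vec_apply)
  have "(\<lambda>v. (cmod (?g v))\<^sup>2) summable_on V \<longleftrightarrow> (\<lambda>v. (cmod (lam v))\<^sup>2) summable_on Chi V Ed u"
    by (rule summable_on_cong_neutral) (use Chi_subset off on in auto)
  then have g: "?g \<in> ell2 V"
    using weights_summable[OF u] by (intro ell2_I shift_fun_outside) auto
  then show dom: "basis_vec u \<in> dom (weighted_shift V Ed lam)"
    unfolding dom_weighted_shift using basis_vec_ell2[OF u] by blast
  have "(\<Sum>\<^sub>\<infinity>v\<in>V. (cmod (?g v))\<^sup>2) = (\<Sum>\<^sub>\<infinity>v\<in>Chi V Ed u. (cmod (lam v))\<^sup>2)"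
    by (rule infsum_cong_neutral) (use Chi_subset off on in auto)
  then show "(shift_norm V Ed lam u)\<^sup>2 = (\<Sum>\<^sub>\<infinity>v\<in>Chi V Ed u. (cmod (lam v))\<^sup>2)"
    by (simp add: shift_norm_def ell2_norm_power2 the_weighted_shift[OF dom])
qed

text \<open>Grouping |S f|^2 by parents turns it into d^2 |f|^2. The resulting equality of domains
  later hands density of the domain of S over to the diagonal operator.\<close>

lemma shift_fun_ell2_iff:
  assumes f: "f \<in> ell2 V"
  shows "shift_fun V Ed lam f \<in> ell2 V \<longleftrightarrow> (\<lambda>v. of_real (shift_norm V Ed lam v) * f v) \<in> ell2 V"
proof -
  let ?g = "\<lambda>v. (cmod (shift_fun V Ed lam f v))\<^sup>2"
  have g: "?g v = (cmod (lam v))\<^sup>2 * (cmod (f u))\<^sup>2" if "v \<in> Chi V Ed u" for u v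
    using that by (simp add: shift_fun_Chi norm_mult power_mult_distrib)
  have "shift_fun V Ed lam f \<in> ell2 V \<longleftrightarrow> ?g summable_on V"
    using shift_fun_outside by (simp add: ell2_def)
  also have "\<dots> \<longleftrightarrow> (\<lambda>u. \<Sum>\<^sub>\<infinity>v\<in>Chi V Ed u. ?g v) summable_on V"
  proof (rule nonneg_summable_on_Chi_iff)
    fix u assume "u \<in> V"
    then have "(\<lambda>v. (cmod (lam v))\<^sup>2 * (cmod (f u))\<^sup>2) summable_on Chi V Ed u"
      by (intro summable_on_cmult_left weights_summable)
    then show "?g summable_on Chi V Ed u"
      using g by (simp cong: summable_on_cong)
  qed (auto simp: shift_fun_off)
  also have "\<dots> \<longleftrightarrow> (\<lambda>u. (cmod (of_real (shift_norm V Ed lam u) * f u))\<^sup>2) summable_on V"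
  proof (rule summable_on_cong)
    fix u assume u: "u \<in> V"
    have "(\<Sum>\<^sub>\<infinity>v\<in>Chi V Ed u. ?g v) = (\<Sum>\<^sub>\<infinity>v\<in>Chi V Ed u. (cmod (lam v))\<^sup>2 * (cmod (f u))\<^sup>2)"
      by (rule infsum_cong) (rule g)
    then show "(\<Sum>\<^sub>\<infinity>v\<in>Chi V Ed u. ?g v) = (cmod (of_real (shift_norm V Ed lam u) * f u))\<^sup>2"
      by (simp add: infsum_cmult_left' norm_mult power_mult_distrib shift_norm_power2[OF u])
  qed
  also have "\<dots> \<longleftrightarrow> (\<lambda>v. of_real (shift_norm V Ed lam v) * f v) \<in> ell2 V"
    using f by (simp add: ell2_def)
  finally show ?thesis .
qed

lemma dom_shift_eq_dom_diag:
  "dom (weighted_shift V Ed lam) = dom (diag_oper V (shift_norm V Ed lam))"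
  unfolding dom_weighted_shift dom_diag_oper using shift_fun_ell2_iff by blast

text \<open>The polarized norm identity. The function d^2 f on the right need not be square
  summable; the identity concerns the sum only. This allows f to range over the domain of S, where
  d^2 f is not yet known to be in \<open>ell2 V\<close>.\<close>

lemma inner_shift_fun:
  assumes "shift_fun V Ed lam k \<in> ell2 V" "shift_fun V Ed lam f \<in> ell2 V"
  shows "ell2_inner V (shift_fun V Ed lam k) (shift_fun V Ed lam f)
    = ell2_inner V k (\<lambda>v. of_real ((shift_norm V Ed lam v)\<^sup>2) * f v)"
proof -
  have "ell2_inner V (shift_fun V Ed lam k) (shift_fun V Ed lam f)
      = (\<Sum>\<^sub>\<infinity>u\<in>V. \<Sum>\<^sub>\<infinity>v\<in>Chi V Ed u. shift_fun V Ed lam k v * cnj (shift_fun V Ed lam f v))"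
    unfolding ell2_inner_def by (rule infsum_Chi) (auto simp: shift_fun_off intro: ell2_inner_summable assms)
  also have "\<dots> = (\<Sum>\<^sub>\<infinity>u\<in>V. k u * cnj (of_real ((shift_norm V Ed lam u)\<^sup>2) * f u))"
  proof (rule infsum_cong)
    fix u assume u: "u \<in> V"
    have "(\<Sum>\<^sub>\<infinity>v\<in>Chi V Ed u. shift_fun V Ed lam k v * cnj (shift_fun V Ed lam f v))
        = (\<Sum>\<^sub>\<infinity>v\<in>Chi V Ed u. complex_of_real ((cmod (lam v))\<^sup>2) * (k u * cnj (f u)))"
      by (rule infsum_cong) (simp add: shift_fun_Chi complex_norm_square mult_ac del: of_real_power)
    also have "\<dots> = of_real ((shift_norm V Ed lam u)\<^sup>2) * (k u * cnj (f u))"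
      by (simp add: infsum_cmult_left' infsum_complex_of_real shift_norm_power2[OF u] del: of_real_power)
    finally show "(\<Sum>\<^sub>\<infinity>v\<in>Chi V Ed u. shift_fun V Ed lam k v * cnj (shift_fun V Ed lam f v))
        = k u * cnj (of_real ((shift_norm V Ed lam u)\<^sup>2) * f u)"
      by (simp add: mult_ac)
  qed
  finally show ?thesis by (simp only: ell2_inner_def)
qed

text \<open>A value h of the product is identified as d^2 f by testing on basis vectors, which also
  shows d^2 f to be square summable. In the other direction \<open>inner_shift_fun\<close> is the
  adjoint relation itself.\<close>

lemma adjoint_comp_weighted_shift:
  "adjoint_oper V (weighted_shift V Ed lam) \<circ>\<^sub>m weighted_shift V Ed lam
    = diag_oper V (\<lambda>v. (shift_norm V Ed lam v)\<^sup>2)"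
proof -
  let ?S = "weighted_shift V Ed lam" and ?d = "shift_norm V Ed lam"
  have "(adjoint_oper V ?S \<circ>\<^sub>m ?S) f = Some h \<longleftrightarrow> diag_oper V (\<lambda>v. (?d v)\<^sup>2) f = Some h" for f h
  proof
    assume "(adjoint_oper V ?S \<circ>\<^sub>m ?S) f = Some h"
    then obtain k where "?S f = Some k" and k: "adjoint_oper V ?S k = Some h"
      by (auto simp: map_comp_Some_iff)
    then have f: "f \<in> ell2 V" and Sf: "shift_fun V Ed lam f \<in> ell2 V" and kk: "k = shift_fun V Ed lam f"
      by (auto simp: weighted_shift_eq_Some_iff)
    from k have h: "h \<in> ell2 V" and
      adj: "\<And>g. g \<in> dom ?S \<Longrightarrow> ell2_inner V (the (?S g)) k = ell2_inner V g h"
      by (auto simp: adjoint_oper_eq_Some_iff[OF basis_vec_dom_shift])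
    have "h u = of_real ((?d u)\<^sup>2) * f u" for u
    proof (cases "u \<in> V")
      case True
      note dom = basis_vec_dom_shift[OF True]
      then have "shift_fun V Ed lam (basis_vec u) \<in> ell2 V"
        unfolding dom_weighted_shift by blast
      from inner_shift_fun[OF this Sf] adj[OF dom]
      have "ell2_inner V (basis_vec u) h = ell2_inner V (basis_vec u) (\<lambda>v. of_real ((?d v)\<^sup>2) * f v)"
        unfolding kk the_weighted_shift[OF dom] by simp
      then show ?thesis
        using True by (metis (no_types, lifting) complex_cnj_cnj ell2_inner_basis_left)
    qed (use f h in \<open>simp add: ell2_zero_outside\<close>)
    then have "h = (\<lambda>u. of_real ((?d u)\<^sup>2) * f u)" ..
    then show "diag_oper V (\<lambda>v. (?d v)\<^sup>2) f = Some h"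
      using f h by (simp only: diag_oper_eq_Some_iff simp_thms)
  next
    assume diag: "diag_oper V (\<lambda>v. (?d v)\<^sup>2) f = Some h"
    then have f: "f \<in> ell2 V" and h: "h \<in> ell2 V" and hh: "h = (\<lambda>v. of_real ((?d v)\<^sup>2) * f v)"
      unfolding diag_oper_eq_Some_iff by blast+
    \<comment> \<open>Membership in the domain of S is not part of the assumption; it comes from
      writing multiplication by d^2 as a product, whose domain lies in that of d.\<close>
    have "(diag_oper V ?d \<circ>\<^sub>m diag_oper V ?d) f = Some h"
      unfolding diag_oper_comp_self by (rule diag)
    then have "f \<in> dom (diag_oper V ?d)" by (auto simp: map_comp_Some_iff)
    then have "f \<in> dom ?S" by (simp only: dom_shift_eq_dom_diag)
    then have Sf: "shift_fun V Ed lam f \<in> ell2 V" unfolding dom_weighted_shift by blast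
    have "adjoint_oper V ?S (shift_fun V Ed lam f) = Some h"
    proof (intro adjoint_oper_eq_Some_iff[THEN iffD2] basis_vec_dom_shift conjI ballI Sf h)
      fix g assume g: "g \<in> dom ?S"
      then have "shift_fun V Ed lam g \<in> ell2 V" unfolding dom_weighted_shift by blast
      then show "ell2_inner V (the (?S g)) (shift_fun V Ed lam f) = ell2_inner V g h"
        unfolding the_weighted_shift[OF g] hh using Sf by (rule inner_shift_fun)
    qed
    moreover have "?S f = Some (shift_fun V Ed lam f)"
      using f Sf by (simp add: weighted_shift_eq_Some_iff)
    ultimately show "(adjoint_oper V ?S \<circ>\<^sub>m ?S) f = Some h"
      by (simp add: map_comp_def)
  qed
  then show ?thesis by (intro ext) (metis option.exhaust)
qed

lemma modulus_weighted_shift: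
  "modulus V (weighted_shift V Ed lam) = diag_oper V (shift_norm V Ed lam)"
proof -
  have "densely_defined V (diag_oper V (shift_norm V Ed lam))"
    using dense unfolding densely_defined_def dom_shift_eq_dom_diag .
  then show ?thesis
    unfolding modulus_def adjoint_comp_weighted_shift
    by (intro oper_sqrt_diag shift_norm_nonneg)
qed

lemma spectral_measure_modulus_weighted_shift:
  "spectral_measure V (modulus V (weighted_shift V Ed lam)) = diag_spectral V (shift_norm V Ed lam)"
  unfolding modulus_weighted_shift by (rule spectral_measure_diag) (rule shift_norm_nonneg)

section \<open>The two quadratic forms as sums over vertices\<close>

lemma spectral_form_modulus:
  assumes f: "f \<in> dom (weighted_shift V Ed lam)" and \<sigma>: "\<sigma> \<in> sets borel_Rplus"
  defines "E \<equiv> spectral_measure V (modulus V (weighted_shift V Ed lam))"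
    and "g \<equiv> \<lambda>u. indicator \<sigma> (shift_norm V Ed lam u) * (shift_norm V Ed lam u)\<^sup>2 * (cmod (f u))\<^sup>2"
  shows "spectral_form V E (the (modulus V (weighted_shift V Ed lam) f)) \<sigma> = infsum g V"
    and "g summable_on V"
proof -
  let ?d = "shift_norm V Ed lam" and ?h = "\<lambda>v. complex_of_real (shift_norm V Ed lam v) * f v"
  have fd: "f \<in> dom (diag_oper V ?d)" using f by (simp only: dom_shift_eq_dom_diag)
  then have h: "?h \<in> ell2 V" unfolding dom_diag_oper by blast
  have g: "g v = indicator \<sigma> (?d v) * (cmod (?h v))\<^sup>2" for v
    by (simp add: g_def norm_mult power_mult_distrib)
  show "spectral_form V E (the (modulus V (weighted_shift V Ed lam) f)) \<sigma> = infsum g V"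
    unfolding E_def spectral_measure_modulus_weighted_shift
    unfolding modulus_weighted_shift the_diag_oper[OF fd] spectral_form_diag_spectral[OF \<sigma> h] g ..
  show "g summable_on V"
    unfolding g by (rule summable_indicator_mult[OF shift_norm_nonneg h])
qed

lemma spectral_form_weighted_shift:
  assumes f: "f \<in> dom (weighted_shift V Ed lam)" and \<sigma>: "\<sigma> \<in> sets borel_Rplus"
  defines "E \<equiv> spectral_measure V (modulus V (weighted_shift V Ed lam))"
    and "g \<equiv> \<lambda>v. indicator \<sigma> (shift_norm V Ed lam v) * (cmod (shift_fun V Ed lam f v))\<^sup>2"
  shows "spectral_form V E (the (weighted_shift V Ed lam f)) \<sigma> = infsum g V"
    and "g summable_on V"
proof -
  have Sf: "shift_fun V Ed lam f \<in> ell2 V" using f unfolding dom_weighted_shift by blast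
  show "spectral_form V E (the (weighted_shift V Ed lam f)) \<sigma> = infsum g V"
    unfolding E_def spectral_measure_modulus_weighted_shift the_weighted_shift[OF f]
      spectral_form_diag_spectral[OF \<sigma> Sf] g_def ..
  show "g summable_on V"
    unfolding g_def by (rule summable_indicator_mult[OF shift_norm_nonneg Sf])
qed

lemma spectral_form_weighted_shift_Chi:
  assumes f: "f \<in> dom (weighted_shift V Ed lam)" and \<sigma>: "\<sigma> \<in> sets borel_Rplus"
  defines "E \<equiv> spectral_measure V (modulus V (weighted_shift V Ed lam))"
    and "w \<equiv> \<lambda>u. (\<Sum>\<^sub>\<infinity>v\<in>Chi V Ed u. indicator \<sigma> (shift_norm V Ed lam v) * (cmod (lam v))\<^sup>2) * (cmod (f u))\<^sup>2"
  shows "spectral_form V E (the (weighted_shift V Ed lam f)) \<sigma> = infsum w V"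
    and "w summable_on V"
proof -
  let ?g = "\<lambda>v. indicator \<sigma> (shift_norm V Ed lam v) * (cmod (shift_fun V Ed lam f v))\<^sup>2"
  have off: "?g v = 0" if "v \<notin> nonroots V Ed" for v
    using that by (simp add: shift_fun_off)
  have summ: "?g summable_on V" using spectral_form_weighted_shift[OF f \<sigma>] by blast
  have w: "(\<Sum>\<^sub>\<infinity>v\<in>Chi V Ed u. ?g v) = w u" for u
  proof -
    have "(\<Sum>\<^sub>\<infinity>v\<in>Chi V Ed u. ?g v)
        = (\<Sum>\<^sub>\<infinity>v\<in>Chi V Ed u. indicator \<sigma> (shift_norm V Ed lam v) * (cmod (lam v))\<^sup>2 * (cmod (f u))\<^sup>2)"
      by (rule infsum_cong) (simp add: shift_fun_Chi norm_mult power_mult_distrib)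
    then show ?thesis by (simp add: w_def infsum_cmult_left')
  qed
  show "spectral_form V E (the (weighted_shift V Ed lam f)) \<sigma> = infsum w V"
    using spectral_form_weighted_shift(1)[OF f \<sigma>] infsum_Chi[OF off summ] unfolding E_def w by simp
  have "?g summable_on Chi V Ed u" for u
    by (rule summable_on_subset_banach[OF summ Chi_subset])
  with nonneg_summable_on_Chi_iff[of ?g] off summ show "w summable_on V"
    unfolding w by simp
qed

lemma singleton_shift_norm_sets: "{shift_norm V Ed lam u} \<in> sets borel_Rplus"
  by (simp add: sets_restrict_space_iff shift_norm_nonneg)

lemma infsum_Chi_e:
  "(\<Sum>\<^sub>\<infinity>v\<in>Chi V Ed u. indicator {shift_norm V Ed lam u} (shift_norm V Ed lam v) * (cmod (lam v))\<^sup>2)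
    = (\<Sum>\<^sub>\<infinity>v\<in>Chi_e V Ed lam u. (cmod (lam v))\<^sup>2)"
  by (rule infsum_cong_neutral) (auto simp: Chi_e_def shift_norm_def)

lemma spectral_forms_basis_vec:
  assumes u: "u \<in> V"
  defines "E \<equiv> spectral_measure V (modulus V (weighted_shift V Ed lam))"
  shows "spectral_form V E (the (modulus V (weighted_shift V Ed lam) (basis_vec u))) {shift_norm V Ed lam u}
      = (shift_norm V Ed lam u)\<^sup>2"
    and "spectral_form V E (the (weighted_shift V Ed lam (basis_vec u))) {shift_norm V Ed lam u}
      = (\<Sum>\<^sub>\<infinity>v\<in>Chi_e V Ed lam u. (cmod (lam v))\<^sup>2)"
  unfolding E_def
    spectral_form_modulus(1)[OF basis_vec_dom_shift[OF u] singleton_shift_norm_sets]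
    spectral_form_weighted_shift_Chi(1)[OF basis_vec_dom_shift[OF u] singleton_shift_norm_sets]
  using u by (simp_all add: infsum_single[of u] basis_vec_apply infsum_Chi_e)

section \<open>Weak quasinormality with a given constant\<close>

lemma wqn_bound_weighted_shift_iff:
  assumes c: "0 \<le> c"
  shows "wqn_bound V (weighted_shift V Ed lam) c \<longleftrightarrow>
    (\<forall>u\<in>V. (shift_norm V Ed lam u)\<^sup>2 \<le> c * (\<Sum>\<^sub>\<infinity>v\<in>Chi_e V Ed lam u. (cmod (lam v))\<^sup>2))"
proof
  assume "wqn_bound V (weighted_shift V Ed lam) c"
  then show "\<forall>u\<in>V. (shift_norm V Ed lam u)\<^sup>2 \<le> c * (\<Sum>\<^sub>\<infinity>v\<in>Chi_e V Ed lam u. (cmod (lam v))\<^sup>2)"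
    unfolding wqn_bound_def using basis_vec_dom_shift singleton_shift_norm_sets spectral_forms_basis_vec
    by metis
next
  let ?d = "shift_norm V Ed lam"
  assume le: "\<forall>u\<in>V. (?d u)\<^sup>2 \<le> c * (\<Sum>\<^sub>\<infinity>v\<in>Chi_e V Ed lam u. (cmod (lam v))\<^sup>2)"
  show "wqn_bound V (weighted_shift V Ed lam) c"
    unfolding wqn_bound_def
  proof (intro conjI ballI c)
    fix \<sigma> f assume \<sigma>: "\<sigma> \<in> sets borel_Rplus" and f: "f \<in> dom (weighted_shift V Ed lam)"
    show "spectral_form V (spectral_measure V (modulus V (weighted_shift V Ed lam)))
         (the (modulus V (weighted_shift V Ed lam) f)) \<sigma>
       \<le> c * spectral_form V (spectral_measure V (modulus V (weighted_shift V Ed lam)))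
         (the (weighted_shift V Ed lam f)) \<sigma>"
      unfolding spectral_form_modulus(1)[OF f \<sigma>] spectral_form_weighted_shift_Chi(1)[OF f \<sigma>]
        infsum_cmult_right'[symmetric]
    proof (rule infsum_mono)
      fix u assume u: "u \<in> V"
      let ?w = "\<Sum>\<^sub>\<infinity>v\<in>Chi V Ed u. indicator \<sigma> (?d v) * (cmod (lam v))\<^sup>2"
      have summ: "(\<lambda>v. indicator \<rho> (?d v) * (cmod (lam v))\<^sup>2) summable_on Chi V Ed u" for \<rho>
        by (rule summable_on_comparison_test[OF weights_summable[OF u]]) (auto simp: indicator_def)
      have "indicator \<sigma> (?d u) * (?d u)\<^sup>2 \<le> c * ?w"
      proof (cases "?d u \<in> \<sigma>")
        case True
        \<comment> \<open>Children in \<open>Chi_e\<close> share the value d u, which lies in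
          \<sigma>; hence they all contribute to \<open>?w\<close>.\<close>
        have "(\<Sum>\<^sub>\<infinity>v\<in>Chi_e V Ed lam u. (cmod (lam v))\<^sup>2) \<le> ?w"
          unfolding infsum_Chi_e[symmetric]
          by (rule infsum_mono[OF summ summ]) (use True in \<open>auto simp: indicator_def\<close>)
        then have "c * (\<Sum>\<^sub>\<infinity>v\<in>Chi_e V Ed lam u. (cmod (lam v))\<^sup>2) \<le> c * ?w"
          using c by (rule mult_left_mono)
        then show ?thesis using le u True by fastforce
      next
        case False
        then show ?thesis using c by (simp add: infsum_nonneg)
      qed
      then have "indicator \<sigma> (?d u) * (?d u)\<^sup>2 * (cmod (f u))\<^sup>2 \<le> c * ?w * (cmod (f u))\<^sup>2"
        by (rule mult_right_mono) simp
      then show "indicator \<sigma> (?d u) * (?d u)\<^sup>2 * (cmod (f u))\<^sup>2 \<le> c * (?w * (cmod (f u))\<^sup>2)"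
        by (simp only: mult.assoc)
    qed (intro summable_on_cmult_right spectral_form_modulus(2)[OF f \<sigma>]
        spectral_form_weighted_shift_Chi(2)[OF f \<sigma>])+
  qed
qed

section \<open>Absolute continuity of the two forms\<close>

lemma null_sets_spectral_form_measure:
  assumes "h \<in> ell2 V"
  defines "E \<equiv> spectral_measure V (modulus V (weighted_shift V Ed lam))"
  shows "\<sigma> \<in> null_sets (spectral_form_measure V E h) \<longleftrightarrow>
    \<sigma> \<in> sets borel_Rplus \<and> spectral_form V E h \<sigma> = 0"
proof -
  have pvm: "projection_valued_measure V E"
    unfolding E_def spectral_measure_modulus_weighted_shift
    by (rule projection_valued_measure_diag_spectral) (rule shift_norm_nonneg)
  show ?thesis
    using emeasure_spectral_form_measure[OF pvm assms(1), of \<sigma>] spectral_form_nonneg[OF pvm assms(1), of \<sigma>]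
    by (auto simp: null_sets_def)
qed

lemma absolutely_continuous_spectral_iff:
  defines "S \<equiv> weighted_shift V Ed lam"
  defines "E \<equiv> spectral_measure V (modulus V S)"
  shows "(\<forall>f\<in>dom S. absolutely_continuous (spectral_form_measure V E (the (S f)))
                                       (spectral_form_measure V E (the (modulus V S f)))) \<longleftrightarrow>
    (\<forall>u\<in>V. shift_norm V Ed lam u \<noteq> 0 \<longrightarrow> Chi' V Ed lam u \<noteq> {})"
proof -
  let ?d = "shift_norm V Ed lam"
  \<comment> \<open>The dominating measure is the first argument of
    \<open>absolutely_continuous\<close>, hence the form of S f comes first.\<close>
  have ac: "absolutely_continuous (spectral_form_measure V E (the (S f)))
      (spectral_form_measure V E (the (modulus V S f))) \<longleftrightarrow>
    (\<forall>\<sigma>\<in>sets borel_Rplus. spectral_form V E (the (S f)) \<sigma> = 0 \<longrightarrow>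
      spectral_form V E (the (modulus V S f)) \<sigma> = 0)" if f: "f \<in> dom S" for f
  proof -
    have "the (S f) \<in> ell2 V"
      using f the_weighted_shift[of f] unfolding S_def dom_weighted_shift by simp
    moreover have "the (modulus V S f) \<in> ell2 V"
    proof -
      have fd: "f \<in> dom (diag_oper V ?d)" using f unfolding S_def dom_shift_eq_dom_diag .
      then have "(\<lambda>v. of_real (?d v) * f v) \<in> ell2 V" unfolding dom_diag_oper by blast
      then show ?thesis
        unfolding S_def modulus_weighted_shift the_diag_oper[OF fd] .
    qed
    ultimately show ?thesis
      unfolding absolutely_continuous_def subset_iff S_def E_def
      by (simp only: null_sets_spectral_form_measure) blast
  qed
  show ?thesis
  proof (intro iffI ballI impI)
    fix u assume all: "\<forall>f\<in>dom S. absolutely_continuous (spectral_form_measure V E (the (S f)))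
        (spectral_form_measure V E (the (modulus V S f)))" and u: "u \<in> V" and du: "?d u \<noteq> 0"
    show "Chi' V Ed lam u \<noteq> {}"
    proof
      assume "Chi' V Ed lam u = {}"
      then have "(\<Sum>\<^sub>\<infinity>v\<in>Chi_e V Ed lam u. (cmod (lam v))\<^sup>2) = 0"
        by (intro infsum_0) (auto simp: Chi'_def)
      then have "(?d u)\<^sup>2 = 0"
        using all ac[of "basis_vec u"] basis_vec_dom_shift[OF u] singleton_shift_norm_sets[of u]
          spectral_forms_basis_vec[OF u] unfolding S_def E_def by auto
      with du show False by simp
    qed
  next
    fix f assume all: "\<forall>u\<in>V. ?d u \<noteq> 0 \<longrightarrow> Chi' V Ed lam u \<noteq> {}" and f: "f \<in> dom S"
    show "absolutely_continuous (spectral_form_measure V E (the (S f)))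
        (spectral_form_measure V E (the (modulus V S f)))"
      unfolding ac[OF f]
    proof (intro ballI impI)
      fix \<sigma> assume \<sigma>: "\<sigma> \<in> sets borel_Rplus" and zero: "spectral_form V E (the (S f)) \<sigma> = 0"
      note f = f[unfolded S_def]
      \<comment> \<open>The sum is left ungrouped here: a vanishing sum of nonnegative terms
        vanishes at each single child, and one child is all that is needed.\<close>
      have Sf: "indicator \<sigma> (?d v) * (cmod (shift_fun V Ed lam f v))\<^sup>2 = 0" if v: "v \<in> V" for v
        using zero spectral_form_weighted_shift[OF f \<sigma>] v unfolding S_def E_def
        by (intro nonneg_infsum_le_0D[of "\<lambda>v. indicator \<sigma> (?d v) * (cmod (shift_fun V Ed lam f v))\<^sup>2" V v])
          simp_all
      have "indicator \<sigma> (?d u) * (?d u)\<^sup>2 * (cmod (f u))\<^sup>2 = 0" if u: "u \<in> V" for u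
      proof (rule ccontr)
        assume "indicator \<sigma> (?d u) * (?d u)\<^sup>2 * (cmod (f u))\<^sup>2 \<noteq> 0"
        then have nz: "?d u \<in> \<sigma>" "?d u \<noteq> 0" "f u \<noteq> 0" by (auto simp: indicator_def)
        \<comment> \<open>For this child d v = d u lies in \<sigma>, and its term |lam v|^2 |f u|^2
          is nonzero, against \<open>Sf\<close>.\<close>
        then obtain v where v: "v \<in> Chi_e V Ed lam u" "lam v \<noteq> 0"
          using all u by (auto simp: Chi'_def)
        then have Chi: "v \<in> Chi V Ed u" and "?d v = ?d u"
          by (auto simp: Chi_e_def shift_norm_def)
        then show False
          using Sf[of v] Chi_subset nz v by (auto simp: shift_fun_Chi)
      qed
      then show "spectral_form V E (the (modulus V S f)) \<sigma> = 0"
        unfolding S_def E_def spectral_form_modulus(1)[OF f \<sigma>] by (rule infsum_0)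
    qed
  qed
qed

end

end

text \<open>A closed nonempty set bounded below contains its infimum, so \<open>LEAST\<close>
  denotes an actual minimum. Upward closure then places every larger c in the set.\<close>

lemma Least_real_le_iff:
  fixes P :: "real \<Rightarrow> bool"
  assumes "closed {c. P c}" "\<And>c. P c \<Longrightarrow> 0 \<le> c" "\<And>c c'. P c \<Longrightarrow> c \<le> c' \<Longrightarrow> P c'"
  shows "(\<exists>c. P c) \<and> (LEAST c. P c) \<le> c \<longleftrightarrow> P c"
proof -
  have least: "P (LEAST c. P c) \<and> (\<forall>c'. P c' \<longrightarrow> (LEAST c. P c) \<le> c')" if "\<exists>c. P c"
  proof -
    have bdd: "bdd_below {c. P c}" using assms(2) by (intro bdd_belowI[of _ 0]) simp
    have "Inf {c. P c} \<in> {c. P c}"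
      using that assms(1) bdd by (intro closed_contains_Inf) auto
    moreover from this have "(LEAST c. P c) = Inf {c. P c}"
      by (intro Least_equality) (auto intro: cInf_lower bdd)
    ultimately show ?thesis by (auto intro: cInf_lower bdd)
  qed
  then show ?thesis using assms(3) by blast
qed

text \<open>An intersection of closed conditions on c, one for each vertex; it guarantees that the
  best constant is attained.\<close>

lemma closed_scaled_bound:
  fixes p q :: "'a \<Rightarrow> real"
  shows "closed {c. 0 \<le> c \<and> (\<forall>u\<in>V. p u \<le> c * q u)}"
proof -
  have "{c. 0 \<le> c \<and> (\<forall>u\<in>V. p u \<le> c * q u)} = {0..} \<inter> (\<Inter>u\<in>V. {c. p u \<le> c * q u})"
    by auto
  also have "closed \<dots>"
    by (intro closed_Int closed_INT ballI closed_atLeast closed_Collect_le continuous_intros)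
  finally show ?thesis .
qed

theorem theorem7p2:
  fixes V :: "'a set" and Ed :: "('a \<times> 'a) set" and lam :: "'a \<Rightarrow> complex"
    and S :: "'a oper" and E :: "real set \<Rightarrow> 'a oper"
  assumes "directed_tree V Ed"
    and "S = weighted_shift V Ed lam"
    and "densely_defined V S"
    and "E = spectral_measure V (modulus V S)"
  shows
    "(\<forall>c::real. 0 \<le> c \<longrightarrow>
        (weakly_quasinormal V S \<and> wqn_const V S \<le> c \<longleftrightarrow>
         (\<forall>u\<in>V. (ell2_norm V (the (S (basis_vec u))))\<^sup>2
                  \<le> c * (\<Sum>\<^sub>\<infinity>v\<in>Chi_e V Ed lam u. (cmod (lam v))\<^sup>2)))) \<and>
     ((\<forall>f\<in>dom S. absolutely_continuous (spectral_form_measure V E (the (S f)))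
                                       (spectral_form_measure V E (the (modulus V S f)))) \<longleftrightarrow>
      (\<forall>u\<in>V. ell2_norm V (the (S (basis_vec u))) \<noteq> 0 \<longrightarrow> Chi' V Ed lam u \<noteq> {}))"
proof (intro conjI allI impI)
  note dense = assms(3)[unfolded assms(2)]
  let ?q = "\<lambda>u. \<Sum>\<^sub>\<infinity>v\<in>Chi_e V Ed lam u. (cmod (lam v))\<^sup>2"
  let ?P = "\<lambda>c. 0 \<le> c \<and> (\<forall>u\<in>V. (shift_norm V Ed lam u)\<^sup>2 \<le> c * ?q u)"
  have norm: "ell2_norm V (the (S (basis_vec u))) = shift_norm V Ed lam u" for u
    by (simp add: shift_norm_def assms(2))
  have wqn: "wqn_bound V S = ?P"
    using wqn_bound_weighted_shift_iff[OF assms(1) dense] unfolding assms(2)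
    by (auto simp: fun_eq_iff wqn_bound_def)
  fix c :: real assume c: "0 \<le> c"
  have "weakly_quasinormal V S \<longleftrightarrow> (\<exists>c. wqn_bound V S c)"
    using linear_weighted_shift[OF assms(1)] closed_weighted_shift[OF assms(1)] dense
    unfolding weakly_quasinormal_def assms(2) by blast
  then have "weakly_quasinormal V S \<and> wqn_const V S \<le> c \<longleftrightarrow> (\<exists>c. ?P c) \<and> (LEAST c. ?P c) \<le> c"
    unfolding wqn_const_def wqn by simp
  also have "\<dots> \<longleftrightarrow> ?P c"
  proof (rule Least_real_le_iff[OF closed_scaled_bound])
    fix c c' assume P: "?P c" and le: "c \<le> c'"
    \<comment> \<open>Admissible constants can be enlarged because the sum \<open>?q u\<close> is
      nonnegative, being 0 when there are no such children.\<close>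
    have "c * ?q u \<le> c' * ?q u" for u
      using le by (intro mult_right_mono infsum_nonneg) auto
    then show "?P c'" using P le by (meson order_trans)
  qed simp
  finally show "weakly_quasinormal V S \<and> wqn_const V S \<le> c \<longleftrightarrow>
      (\<forall>u\<in>V. (ell2_norm V (the (S (basis_vec u))))\<^sup>2 \<le> c * ?q u)"
    using c unfolding norm by simp
next
  show "(\<forall>f\<in>dom S. absolutely_continuous (spectral_form_measure V E (the (S f)))
        (spectral_form_measure V E (the (modulus V S f)))) \<longleftrightarrow>
      (\<forall>u\<in>V. ell2_norm V (the (S (basis_vec u))) \<noteq> 0 \<longrightarrow> Chi' V Ed lam u \<noteq> {})"
    using absolutely_continuous_spectral_iff[OF assms(1) assms(3)[unfolded assms(2)]]
    unfolding assms(4) assms(2) shift_norm_def .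
qed

end
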